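(* For any finite-dimensional $\mathbb{G}_a^{(1|1)}$-module $M$, the superspace $\mathrm{Gr}^{ev}(M):=\bigoplus_{i\in\mathbb{Z}}\mathrm{Gr}^{2i}(M)$ has a unique structure of $\mathfrak{osp}(1|2)$-module such that $h$ acts by the grading (by the scalar $2i$ on $\mathrm{Gr}^{2i}(M)$) and $X$ acts as $\mathrm{Gr}(x)$.
   Context: Base field: algebraically closed of characteristic $0$. $\mathbb{G}_a^{(1|1)}$ is the $(1|1)$-dimensional algebraic supergroup with even part $\mathbb{G}_a$ whose Lie superalgebra has basis $x,[x,x]$ with $x$ odd and $[x,[x,x]]=0$; a finite-dimensional representation is a finite-dimensional superspace $M$ with an odd nilpotent operator $x$. $\Pi$ denotes parity shift. Deligne filtration: such an $x$ defines a canonical finite increasing filtration $\ldots\subset\mathcal{F}^i(M)\subset\mathcal{F}^{i+1}(M)\subset\ldots$ ($i\in\mathbb{Z}$) of $M$ characterized by: $x(\mathcal{F}^i(M))\subset\mathcal{F}^{i-2}(M)$; and, with $\mathrm{Gr}^i(M)=\mathcal{F}^i(M)/\mathcal{F}^{i-1}(M)$, the map $x^i:\mathrm{Gr}^i(M)\to\Pi^i\mathrm{Gr}^{-i}(M)$ is an isomorphism for all $i\ge 0$. $\mathrm{Gr}(x)$ is the induced odd operator, mapping $\mathrm{Gr}^i(M)$ to $\mathrm{Gr}^{i-2}(M)$. The Lie superalgebra $\mathfrak{osp}(1|2)$ is generated by an even element $h$ (spanning the Cartan subalgebra of $\mathfrak{osp}(1|2)_{\bar 0}\cong\mathfrak{sl}_2$)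 and odd elements $X,Y$ (a basis of $\mathfrak{osp}(1|2)_{\bar 1}$), with relations $[h,X]=-2X$, $[h,Y]=2Y$, $[Y,X]=h$. *)

theory Defs
  imports
    "HOL-Analysis.Cartesian_Space"
    "HOL-Algebra.Algebraic_Closure_Type"
    "HOL-Library.Z2"
begin

no_notation fps_nth (infixl \<open>$\<close> 75)
no_notation Sum_Type.Plus (infixr \<open><+>\<close> 65)

section \<open>Superspaces\<close>

text \<open>
  Vector spaces over the field \<open>'k\<close> are modules over \<open>ring_of_type_algebra :: 'k ring\<close>.
  Parities are elements of \<open>bit\<close>, the field with two elements. The fields \<open>mult\<close> and \<open>one\<close>
  that the module record inherits from the ring record play no role.
\<close>

record ('k, 'v) superspace = "('k, 'v) module" +
  part :: "bit \<Rightarrow> 'v set"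

abbreviation (input) scalars :: "'k::field ring"
  where "scalars \<equiv> ring_of_type_algebra"

locale superspace = module "scalars :: 'k ring" V
  for V :: "('k::field, 'v, 'z) superspace_scheme" (structure) +
  assumes part_submodule: "submodule (part V p) scalars V"
    and part_sum: "part V 0 <+> part V 1 = carrier V"
    and part_Int: "part V 0 \<inter> part V 1 = {\<zero>}"

definition finite_dimensional :: "('k::field, 'v, 'z) superspace_scheme \<Rightarrow> bool"
  where "finite_dimensional V \<longleftrightarrow>
    (\<exists>B. finite B \<and> B \<subseteq> carrier V \<and>
      (\<forall>v\<in>carrier V. \<exists>c. v = (\<Oplus>\<^bsub>V\<^esub>b\<in>B. c b \<odot>\<^bsub>V\<^esub> b)))"

definition linear_maps ::
    "('k::field, 'v, 'y) superspace_scheme \<Rightarrow> ('k, 'w, 'z) superspace_scheme \<Rightarrow> ('v \<Rightarrow> 'w) set"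
  where "linear_maps V W =
    {f \<in> hom (add_monoid V) (add_monoid W). \<forall>c. \<forall>v\<in>carrier V. f (c \<odot>\<^bsub>V\<^esub> v) = c \<odot>\<^bsub>W\<^esub> f v}"

definition odd_operator :: "('k::field, 'v, 'z) superspace_scheme \<Rightarrow> ('v \<Rightarrow> 'v) \<Rightarrow> bool"
  where "odd_operator V f \<longleftrightarrow> f \<in> linear_maps V V \<and> (\<forall>p. f ` part V p \<subseteq> part V (p + 1))"

definition superspace_iso ::
    "('k::field, 'v, 'y) superspace_scheme \<Rightarrow> ('k, 'w, 'z) superspace_scheme \<Rightarrow> ('v \<Rightarrow> 'w) \<Rightarrow> bool"
  where "superspace_iso V W f \<longleftrightarrow>
    f \<in> linear_maps V W \<and> bij_betw f (carrier V) (carrier W) \<and> (\<forall>p. f ` part V p = part W p)"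

text \<open>The \<open>n\<close>-fold parity shift \<open>\<Pi>\<^sup>n V\<close>.\<close>

definition parity_shift ::
    "nat \<Rightarrow> ('k::field, 'v, 'z) superspace_scheme \<Rightarrow> ('k, 'v, 'z) superspace_scheme"
  where "parity_shift n V = V\<lparr>part := \<lambda>p. part V (p + of_nat n)\<rparr>"

definition subsuperspace :: "'v set \<Rightarrow> ('k::field, 'v, 'z) superspace_scheme \<Rightarrow> bool"
  where "subsuperspace W V \<longleftrightarrow>
    submodule W scalars V \<and> W = (W \<inter> part V 0) <+>\<^bsub>V\<^esub> (W \<inter> part V 1)"

definition restrict_to ::
    "('k::field, 'v, 'z) superspace_scheme \<Rightarrow> 'v set \<Rightarrow> ('k, 'v, 'z) superspace_scheme"
  where "restrict_to V W = V\<lparr>carrier := W, part := \<lambda>p. W \<inter> part V p\<rparr>"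

text \<open>The quotient consists of cosets. Scaling is not just the elementwise image of a coset,
  which would be wrong for the scalar \<open>0\<close>.\<close>

definition quotient ::
    "('k::field, 'v, 'z) superspace_scheme \<Rightarrow> 'v set \<Rightarrow> ('k, 'v set) superspace"
  where "quotient V W =
    \<lparr>carrier = a_rcosets\<^bsub>V\<^esub> W, monoid.mult = undefined, one = undefined,
     zero = W, add = (\<lambda>A B. A <+>\<^bsub>V\<^esub> B),
     module.smult = (\<lambda>c A. \<Union>a\<in>A. W +>\<^bsub>V\<^esub> (c \<odot>\<^bsub>V\<^esub> a)),
     part = (\<lambda>p. (\<lambda>v. W +>\<^bsub>V\<^esub> v) ` part V p)\<rparr>"

definition direct_sum :: "('i \<Rightarrow> ('k::field, 'v) superspace) \<Rightarrow> ('k, 'i \<Rightarrow> 'v) superspace"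
  where "direct_sum V =
    \<lparr>carrier = {u. (\<forall>i. u i \<in> carrier (V i)) \<and> finite {i. u i \<noteq> \<zero>\<^bsub>V i\<^esub>}},
     monoid.mult = undefined, one = undefined,
     zero = (\<lambda>i. \<zero>\<^bsub>V i\<^esub>), add = (\<lambda>u w i. u i \<oplus>\<^bsub>V i\<^esub> w i),
     module.smult = (\<lambda>c u i. c \<odot>\<^bsub>V i\<^esub> u i),
     part = (\<lambda>p. {u. (\<forall>i. u i \<in> part (V i) p) \<and> finite {i. u i \<noteq> \<zero>\<^bsub>V i\<^esub>}})\<rparr>"


section \<open>Representations of the odd additive supergroup and the Deligne filtration\<close>

definition Ga11_module :: "('k::field, 'm) superspace \<Rightarrow> ('m \<Rightarrow> 'm) \<Rightarrow> bool"
  where "Ga11_module M x \<longleftrightarrow>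
    superspace M \<and> finite_dimensional M \<and> odd_operator M x \<and>
    (\<exists>n. \<forall>v\<in>carrier M. (x ^^ n) v = \<zero>\<^bsub>M\<^esub>)"

definition Gr :: "('k::field, 'm) superspace \<Rightarrow> (int \<Rightarrow> 'm set) \<Rightarrow> int \<Rightarrow> ('k, 'm set) superspace"
  where "Gr M F i = quotient (restrict_to M (F i)) (F (i - 1))"

text \<open>The map \<open>Gr\<^sup>i(M) \<rightarrow> Gr\<^sup>j(M)\<close> induced by an operator \<open>f\<close> of \<open>M\<close> that sends
  \<open>F\<^sup>i\<close> to \<open>F\<^sup>j\<close> and \<open>F\<^sup>i\<^sup>-\<^sup>1\<close> to \<open>F\<^sup>j\<^sup>-\<^sup>1\<close>; the union is over equal cosets.
  It only depends on the target degree \<open>j\<close>.\<close>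

definition Gr_map ::
    "('k::field, 'm) superspace \<Rightarrow> (int \<Rightarrow> 'm set) \<Rightarrow> ('m \<Rightarrow> 'm) \<Rightarrow> int \<Rightarrow> 'm set \<Rightarrow> 'm set"
  where "Gr_map M F f j A = (\<Union>a\<in>A. F (j - 1) +>\<^bsub>M\<^esub> f a)"

definition is_deligne_filtration ::
    "('k::field, 'm) superspace \<Rightarrow> ('m \<Rightarrow> 'm) \<Rightarrow> (int \<Rightarrow> 'm set) \<Rightarrow> bool"
  where "is_deligne_filtration M x F \<longleftrightarrow>
    (\<forall>i. subsuperspace (F i) M) \<and>
    (\<forall>i. F i \<subseteq> F (i + 1)) \<and> (\<exists>i. F i = {\<zero>\<^bsub>M\<^esub>}) \<and> (\<exists>i. F i = carrier M) \<and>
    (\<forall>i. x ` F i \<subseteq> F (i - 2)) \<and>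
    (\<forall>i::nat. superspace_iso (Gr M F (int i)) (parity_shift i (Gr M F (- int i)))
       (Gr_map M F (x ^^ i) (- int i)))"

definition deligne_filtration ::
    "('k::field, 'm) superspace \<Rightarrow> ('m \<Rightarrow> 'm) \<Rightarrow> int \<Rightarrow> 'm set"
  where "deligne_filtration M x = (THE F. is_deligne_filtration M x F)"

text \<open>A vector of \<open>Gr_ev M x\<close> is a function whose value at \<open>i\<close> is its component in
  \<open>Gr\<^sup>2\<^sup>i(M)\<close>.\<close>

definition Gr_ev :: "('k::field, 'm) superspace \<Rightarrow> ('m \<Rightarrow> 'm) \<Rightarrow> ('k, int \<Rightarrow> 'm set) superspace"
  where "Gr_ev M x = direct_sum (\<lambda>i. Gr M (deligne_filtration M x) (2 * i))"

definition Gr_ev_x ::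
    "('k::field, 'm) superspace \<Rightarrow> ('m \<Rightarrow> 'm) \<Rightarrow> (int \<Rightarrow> 'm set) \<Rightarrow> int \<Rightarrow> 'm set"
  where "Gr_ev_x M x u = (\<lambda>i. Gr_map M (deligne_filtration M x) x (2 * i) (u (i + 1)))"

definition Gr_ev_grading ::
    "('k::field, 'm) superspace \<Rightarrow> ('m \<Rightarrow> 'm) \<Rightarrow> (int \<Rightarrow> 'm set) \<Rightarrow> int \<Rightarrow> 'm set"
  where "Gr_ev_grading M x u =
    (\<lambda>i. (of_int (2 * i) :: 'k) \<odot>\<^bsub>Gr M (deligne_filtration M x) (2 * i)\<^esub> u i)"


section \<open>Lie superalgebras and their modules\<close>

definition koszul_sign :: "bit \<Rightarrow> bit \<Rightarrow> 'k::field"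
  where "koszul_sign p q = (if p = 1 \<and> q = 1 then - 1 else 1)"

record ('k, 'v) lie_superalgebra = "('k, 'v) superspace" +
  bracket :: "'v \<Rightarrow> 'v \<Rightarrow> 'v"

locale lie_superalgebra = superspace L
  for L :: "('k::field, 'v, 'z) lie_superalgebra_scheme" (structure) +
  assumes bracket_linear_left: "b \<in> carrier L \<Longrightarrow> (\<lambda>a. bracket L a b) \<in> linear_maps L L"
    and bracket_linear_right: "a \<in> carrier L \<Longrightarrow> bracket L a \<in> linear_maps L L"
    and bracket_parity:
      "\<lbrakk>a \<in> part L p; b \<in> part L q\<rbrakk> \<Longrightarrow> bracket L a b \<in> part L (p + q)"
    and super_antisymmetry:
      "\<lbrakk>a \<in> part L p; b \<in> part L q\<rbrakk> \<Longrightarrow>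
        bracket L a b = \<ominus> (koszul_sign p q \<odot> bracket L b a)"
    and super_jacobi:
      "\<lbrakk>a \<in> part L p; b \<in> part L q; c \<in> part L r\<rbrakk> \<Longrightarrow>
        bracket L a (bracket L b c) =
          bracket L (bracket L a b) c \<oplus> koszul_sign p q \<odot> bracket L b (bracket L a c)"

locale lie_superalgebra_module = L: lie_superalgebra L + V: superspace V
  for L :: "('k::field, 'l, 'y) lie_superalgebra_scheme"
    and V :: "('k, 'v, 'z) superspace_scheme" +
  fixes act :: "'l \<Rightarrow> 'v \<Rightarrow> 'v"
  assumes act_linear_left: "v \<in> carrier V \<Longrightarrow> (\<lambda>a. act a v) \<in> linear_maps L V"
    and act_linear_right: "a \<in> carrier L \<Longrightarrow> act a \<in> linear_maps V V"
    and act_parity: "\<lbrakk>a \<in> part L p; v \<in> part V q\<rbrakk> \<Longrightarrow> act a v \<in> part V (p + q)"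
    and act_bracket:
      "\<lbrakk>a \<in> part L p; b \<in> part L q; v \<in> carrier V\<rbrakk> \<Longrightarrow>
        act (bracket L a b) v =
          act a (act b v) \<ominus>\<^bsub>V\<^esub> koszul_sign p q \<odot>\<^bsub>V\<^esub> act b (act a v)"


section \<open>The Lie superalgebra osp(1|2)\<close>

text \<open>
  We realise it by matrices acting on the space with basis \<open>e\<^sub>1\<close> (even) and \<open>e\<^sub>2\<close>, \<open>e\<^sub>3\<close> (odd),
  preserving the even supersymmetric form with \<open>(e\<^sub>1, e\<^sub>1) = 1\<close>,
  \<open>(e\<^sub>2, e\<^sub>3) = 1 = - (e\<^sub>3, e\<^sub>2)\<close>. A homogeneous matrix \<open>A\<close> of parity \<open>p\<close> belongs to it iff
  \<open>(A v, w) + (-1)\<^sup>p\<^sup>q (v, A w) = 0\<close> for all \<open>v\<close> of parity \<open>q\<close> and all \<open>w\<close>.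
\<close>

definition index_parity :: "3 \<Rightarrow> bit"
  where "index_parity i = (if i = 1 then 0 else 1)"

definition mat_component :: "bit \<Rightarrow> 'k::field^3^3 \<Rightarrow> 'k^3^3"
  where "mat_component p A =
    (\<chi> i j. if index_parity i + index_parity j = p then A $ i $ j else 0)"

definition mat_scale :: "'k::field \<Rightarrow> 'k^3^3 \<Rightarrow> 'k^3^3"
  where "mat_scale c A = (\<chi> i j. c * A $ i $ j)"

definition mat_superbracket :: "'k::field^3^3 \<Rightarrow> 'k^3^3 \<Rightarrow> 'k^3^3"
  where "mat_superbracket A B =
    (\<Sum>p\<in>{0, 1}. \<Sum>q\<in>{0, 1}.
      mat_component p A ** mat_component q B
        - mat_scale (koszul_sign p q) (mat_component q B ** mat_component p A))"

definition osp_form :: "'k::field^3^3"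
  where "osp_form = vector [vector [1, 0, 0], vector [0, 0, 1], vector [0, - 1, 0]]"

definition osp12_part :: "bit \<Rightarrow> ('k::field^3^3) set"
  where "osp12_part p =
    {A. mat_component p A = A \<and>
      (\<forall>i j. (\<Sum>k\<in>UNIV. A $ k $ i * osp_form $ k $ j)
        + koszul_sign p (index_parity i) * (\<Sum>k\<in>UNIV. osp_form $ i $ k * A $ k $ j) = 0)}"

definition osp12 :: "('k::field, 'k^3^3) lie_superalgebra"
  where "osp12 =
    \<lparr>carrier = {A + B |A B. A \<in> osp12_part 0 \<and> B \<in> osp12_part 1},
     monoid.mult = undefined, one = undefined, zero = 0, add = (+),
     module.smult = mat_scale, part = osp12_part, bracket = mat_superbracket\<rparr>"

definition osp_h :: "'k::field^3^3"
  where "osp_h = vector [vector [0, 0, 0], vector [0, 2, 0], vector [0, 0, - 2]]"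

definition osp_X :: "'k::field^3^3"
  where "osp_X = vector [vector [0, 1, 0], vector [0, 0, 0], vector [1, 0, 0]]"

definition osp_Y :: "'k::field^3^3"
  where "osp_Y = vector [vector [0, 0, - 2], vector [2, 0, 0], vector [0, 0, 0]]"

text \<open>The algebra generated by \<open>h\<close>, \<open>X\<close>, \<open>Y\<close> is all of it, since
  \<open>h\<close>, \<open>[X, X]\<close>, \<open>[Y, Y]\<close> span the even part and \<open>X\<close>, \<open>Y\<close> the odd part.\<close>

lemma index_parity_simps [simp]:
  "index_parity 1 = 0" "index_parity 2 = 1" "index_parity 3 = 1"
  by (simp_all add: index_parity_def)

lemma koszul_sign_simps [simp]:
  "koszul_sign 0 q = 1" "koszul_sign p 0 = 1" "koszul_sign 1 1 = - 1"
  by (simp_all add: koszul_sign_def)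

lemmas mat3_simps = vec_eq_iff forall_3 sum_3 matrix_matrix_mult_def mat_component_def
  mat_scale_def osp_form_def osp_h_def osp_X_def osp_Y_def

lemma osp12_part_0_iff:
  fixes A :: "'k::field_char_0^3^3"
  shows "A \<in> osp12_part 0 \<longleftrightarrow>
    A $ 1 $ 1 = 0 \<and> A $ 1 $ 2 = 0 \<and> A $ 1 $ 3 = 0 \<and> A $ 2 $ 1 = 0 \<and> A $ 3 $ 1 = 0 \<and>
    A $ 3 $ 3 = - (A $ 2 $ 2)"
  by (auto simp: osp12_part_def mat3_simps eq_neg_iff_add_eq_0 neg_eq_iff_add_eq_0 algebra_simps)

lemma osp12_part_1_iff:
  fixes A :: "'k::field_char_0^3^3"
  shows "A \<in> osp12_part 1 \<longleftrightarrow>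
    A $ 1 $ 1 = 0 \<and> A $ 2 $ 2 = 0 \<and> A $ 2 $ 3 = 0 \<and> A $ 3 $ 2 = 0 \<and> A $ 3 $ 3 = 0 \<and>
    A $ 1 $ 3 = - (A $ 2 $ 1) \<and> A $ 3 $ 1 = A $ 1 $ 2"
  by (auto simp: osp12_part_def mat3_simps eq_neg_iff_add_eq_0 neg_eq_iff_add_eq_0 algebra_simps)

lemma osp_generators:
  "osp_h \<in> (osp12_part 0 :: ('k::field_char_0^3^3) set)"
  "osp_X \<in> (osp12_part 1 :: ('k^3^3) set)" "osp_Y \<in> (osp12_part 1 :: ('k^3^3) set)"
  by (simp_all add: osp12_part_0_iff osp12_part_1_iff mat3_simps)

lemma osp_relations:
  "mat_superbracket osp_h osp_X = mat_scale (- 2) (osp_X :: 'k::field_char_0^3^3)"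
  "mat_superbracket osp_h osp_Y = mat_scale 2 (osp_Y :: 'k^3^3)"
  "mat_superbracket osp_Y osp_X = (osp_h :: 'k^3^3)"
  by (simp_all add: mat_superbracket_def mat3_simps)

lemma osp12_part_basis:
  fixes A :: "'k::field_char_0^3^3"
  shows "A \<in> osp12_part 0 \<longleftrightarrow> (\<exists>a b c. A = mat_scale a osp_h
      + mat_scale b (mat_superbracket osp_X osp_X) + mat_scale c (mat_superbracket osp_Y osp_Y))"
    and "A \<in> osp12_part 1 \<longleftrightarrow> (\<exists>a b. A = mat_scale a osp_X + mat_scale b osp_Y)"
proof -
  have 0: "A = mat_scale (A $ 2 $ 2 / 2) osp_h + mat_scale (A $ 3 $ 2 / 2) (mat_superbracket osp_X osp_X)
      + mat_scale (- (A $ 2 $ 3) / 8) (mat_superbracket osp_Y osp_Y)" if "A \<in> osp12_part 0"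
    using that by (simp add: osp12_part_0_iff mat_superbracket_def mat3_simps)
  show "A \<in> osp12_part 0 \<longleftrightarrow> (\<exists>a b c. A = mat_scale a osp_h
      + mat_scale b (mat_superbracket osp_X osp_X) + mat_scale c (mat_superbracket osp_Y osp_Y))"
  proof
    assume "\<exists>a b c. A = mat_scale a osp_h
      + mat_scale b (mat_superbracket osp_X osp_X) + mat_scale c (mat_superbracket osp_Y osp_Y)"
    then show "A \<in> osp12_part 0"
      by (auto simp: osp12_part_0_iff mat_superbracket_def mat3_simps)
  qed (use 0 in blast)
  have 1: "A = mat_scale (A $ 1 $ 2) osp_X + mat_scale (A $ 2 $ 1 / 2) osp_Y" if "A \<in> osp12_part 1"
    using that by (simp add: osp12_part_1_iff mat3_simps)
  show "A \<in> osp12_part 1 \<longleftrightarrow> (\<exists>a b. A = mat_scale a osp_X + mat_scale b osp_Y)"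
  proof
    assume "\<exists>a b. A = mat_scale a osp_X + mat_scale b osp_Y"
    then show "A \<in> osp12_part 1"
      by (auto simp: osp12_part_1_iff mat3_simps)
  qed (use 1 in blast)
qed

lemma osp12_simps [simp]:
  "part osp12 = osp12_part" "bracket osp12 = mat_superbracket" "add osp12 = (+)"
  "zero osp12 = 0" "module.smult osp12 = mat_scale"
  by (simp_all add: osp12_def)

lemma osp12_carrier_iff:
  fixes A :: "'k::field_char_0^3^3"
  shows "A \<in> carrier osp12 \<longleftrightarrow>
    A $ 1 $ 1 = 0 \<and> A $ 3 $ 3 = - (A $ 2 $ 2) \<and> A $ 1 $ 3 = - (A $ 2 $ 1) \<and> A $ 3 $ 1 = A $ 1 $ 2"
    (is "?L \<longleftrightarrow> ?R")
proof
  assume ?L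
  then show ?R
    by (auto simp: osp12_def osp12_part_0_iff osp12_part_1_iff)
next
  assume R: ?R
  have "mat_component 0 A \<in> osp12_part 0" "mat_component 1 A \<in> osp12_part 1"
    using R by (simp_all add: osp12_part_0_iff osp12_part_1_iff mat3_simps)
  moreover have "A = mat_component 0 A + mat_component 1 A"
    by (simp add: mat3_simps)
  ultimately show ?L
    by (auto simp: osp12_def)
qed

lemma osp12_module: "module scalars (osp12 :: ('k::field_char_0, 'k^3^3) lie_superalgebra)"
proof (rule moduleI)
  show "cring (scalars :: 'k ring)" by (rule cring_from_type_algebra)
  show "abelian_group (osp12 :: ('k, 'k^3^3) lie_superalgebra)"
  proof (rule abelian_groupI)
    fix A :: "'k^3^3"
    assume "A \<in> carrier osp12"
    then have "- A \<in> carrier osp12"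
      by (simp add: osp12_carrier_iff)
    then show "\<exists>B\<in>carrier osp12. B \<oplus>\<^bsub>osp12\<^esub> A = \<zero>\<^bsub>osp12\<^esub>"
      by (intro bexI[of _ "- A"]) auto
  qed (auto simp: osp12_carrier_iff add_ac)
qed (auto simp: osp12_carrier_iff ring_of_type_algebra_def mat3_simps algebra_simps)

lemma osp12_superspace: "superspace (osp12 :: ('k::field_char_0, 'k^3^3) lie_superalgebra)"
proof -
  let ?L = "osp12 :: ('k, 'k^3^3) lie_superalgebra"
  interpret module "scalars :: 'k ring" ?L by (rule osp12_module)
  have uminus: "\<ominus>\<^bsub>?L\<^esub> A = - A" if "A \<in> carrier ?L" for A
  proof -
    have "- A \<in> carrier ?L"
      using that by (simp add: osp12_carrier_iff)
    then show ?thesis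
      using that minus_equality[of "- A" A] by simp
  qed
  have sub: "submodule (part ?L p) scalars ?L" for p
  proof (rule submoduleI)
    show "part ?L p \<subseteq> carrier ?L"
      by (cases p) (auto simp: osp12_carrier_iff osp12_part_0_iff osp12_part_1_iff)
    then show "\<ominus>\<^bsub>?L\<^esub> A \<in> part ?L p" if "A \<in> part ?L p" for A
      using that uminus[of A]
      by (cases p) (auto simp: osp12_part_0_iff osp12_part_1_iff)
  qed (cases p; auto simp: osp12_part_0_iff osp12_part_1_iff mat_scale_def)+
  show ?thesis
  proof (intro superspace.intro superspace_axioms.intro osp12_module)
    show "part ?L 0 <+>\<^bsub>?L\<^esub> part ?L 1 = carrier ?L"
      by (auto simp: osp12_def set_add_def')
    show "part ?L 0 \<inter> part ?L 1 = {\<zero>\<^bsub>?L\<^esub>}"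
      by (auto simp: osp12_part_0_iff osp12_part_1_iff mat3_simps)
  qed (rule sub)
qed

lemma mat_superbracket_homogeneous:
  fixes A B :: "'k::field_char_0^3^3"
  assumes "mat_component p A = A" "mat_component q B = B"
  shows "mat_superbracket A B = A ** B - mat_scale (koszul_sign p q) (B ** A)"
proof -
  have "mat_component r A = (if r = p then A else 0)" for r
    using assms(1) by (cases r; cases p) (simp_all add: vec_eq_iff forall_3 mat_component_def)
  moreover have "mat_component r B = (if r = q then B else 0)" for r
    using assms(2) by (cases r; cases q) (simp_all add: vec_eq_iff forall_3 mat_component_def)
  moreover have "mat_scale c (0 :: 'k^3^3) = 0" for c
    by (simp add: vec_eq_iff mat_scale_def)
  ultimately show ?thesis
    by (cases p; cases q) (simp_all add: mat_superbracket_def)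
qed

lemma osp12_part_component: "A \<in> osp12_part p \<Longrightarrow> mat_component p A = A"
  by (simp add: osp12_part_def)

lemma osp12_bracket_parity:
  fixes A B :: "'k::field_char_0^3^3"
  assumes "A \<in> osp12_part p" "B \<in> osp12_part q"
  shows "mat_superbracket A B \<in> osp12_part (p + q)"
  using assms mat_superbracket_homogeneous[OF assms[THEN osp12_part_component]]
  by (cases p; cases q)
    (simp_all add: osp12_part_0_iff osp12_part_1_iff matrix_matrix_mult_def sum_3 mat_scale_def)

lemma osp12_super_jacobi:
  fixes A B C :: "'k::field_char_0^3^3"
  assumes "A \<in> osp12_part p" "B \<in> osp12_part q" "C \<in> osp12_part r"
  shows "mat_superbracket A (mat_superbracket B C) = mat_superbracket (mat_superbracket A B) C
    + mat_scale (koszul_sign p q) (mat_superbracket B (mat_superbracket A C))"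
proof -
  note hom = mat_superbracket_homogeneous[OF osp12_part_component osp12_part_component]
  have linear: "S ** (T - U) = S ** T - S ** U" "(T - U) ** S = T ** S - U ** S"
      "S ** (T + U) = S ** T + S ** U" "(T + U) ** S = T ** S + U ** S" for S T U :: "'k^3^3"
    by (simp_all add: vec_eq_iff matrix_matrix_mult_def sum_subtractf sum.distrib algebra_simps)
  have scale: "mat_scale 1 S = S" "mat_scale (- 1) S = - S"
      "S ** (- T) = - (S ** T)" "(- S) ** T = - (S ** T)" for S T :: "'k^3^3"
    by (simp_all add: vec_eq_iff mat_scale_def matrix_matrix_mult_def sum_negf)
  note parity = osp12_bracket_parity[OF assms(1,2)] osp12_bracket_parity[OF assms(1,3)]
    osp12_bracket_parity[OF assms(2,3)]
  show ?thesis
    unfolding hom[OF assms(1) parity(3)] hom[OF parity(1) assms(3)] hom[OF assms(2) parity(2)]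
    unfolding hom[OF assms(1,2)] hom[OF assms(1,3)] hom[OF assms(2,3)]
    by (cases p; cases q; cases r)
      (simp_all add: scale linear matrix_mul_assoc algebra_simps)
qed

lemma mat_component_linear:
  "mat_component p (A + B) = mat_component p A + mat_component p B"
  "mat_component p (mat_scale c A) = mat_scale c (mat_component p A)"
  by (simp_all add: vec_eq_iff mat_component_def mat_scale_def)

lemma mat_mult_linear:
  fixes A B C :: "'k::field^3^3"
  shows "(A + B) ** C = A ** C + B ** C" "C ** (A + B) = C ** A + C ** B"
    "mat_scale c A ** B = mat_scale c (A ** B)" "A ** mat_scale c B = mat_scale c (A ** B)"
  by (simp_all add: vec_eq_iff matrix_matrix_mult_def mat_scale_def sum.distrib
      sum_distrib_left algebra_simps)

lemma mat_scale_linear: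
  "mat_scale c (A + B) = mat_scale c A + mat_scale c B"
  "mat_scale c (A - B) = mat_scale c A - mat_scale c B"
  "mat_scale c (mat_scale d A) = mat_scale d (mat_scale c A)"
  by (simp_all add: vec_eq_iff mat_scale_def algebra_simps)

lemma mat_superbracket_linear:
  fixes A B C :: "'k::field^3^3"
  shows "mat_superbracket (A + B) C = mat_superbracket A C + mat_superbracket B C"
    "mat_superbracket C (A + B) = mat_superbracket C A + mat_superbracket C B"
    "mat_superbracket (mat_scale c A) B = mat_scale c (mat_superbracket A B)"
    "mat_superbracket A (mat_scale c B) = mat_scale c (mat_superbracket A B)"
proof -
  have "mat_scale c (\<Sum>p\<in>P. f p) = (\<Sum>p\<in>P. mat_scale c (f p))"
    for P :: "bit set" and f :: "bit \<Rightarrow> 'k^3^3"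
    by (simp add: vec_eq_iff mat_scale_def sum_distrib_left)
  note lin = this mat_component_linear mat_mult_linear mat_scale_linear
  show "mat_superbracket (A + B) C = mat_superbracket A C + mat_superbracket B C"
    and "mat_superbracket C (A + B) = mat_superbracket C A + mat_superbracket C B"
    unfolding mat_superbracket_def lin
    by (simp_all only: sum.distrib[symmetric] add_diff_add)
  show "mat_superbracket (mat_scale c A) B = mat_scale c (mat_superbracket A B)"
    and "mat_superbracket A (mat_scale c B) = mat_scale c (mat_superbracket A B)"
    unfolding mat_superbracket_def lin by (simp_all only: mat_scale_linear(3)[of c])
qed

lemma osp12_lie_superalgebra:
  "lie_superalgebra (osp12 :: ('k::field_char_0, 'k^3^3) lie_superalgebra)"
proof -
  let ?L = "osp12 :: ('k, 'k^3^3) lie_superalgebra"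
  interpret superspace ?L by (rule osp12_superspace)
  have uminus: "\<ominus>\<^bsub>?L\<^esub> A = - A" if "A \<in> carrier ?L" for A
  proof -
    have "- A \<in> carrier ?L"
      using that by (simp add: osp12_carrier_iff)
    then show ?thesis
      using that minus_equality[of "- A" A] by simp
  qed
  have part_sub: "part ?L p \<subseteq> carrier ?L" for p
    using submoduleE(1)[OF part_submodule] .
  have scale_closed: "mat_scale c A \<in> carrier ?L" if "A \<in> carrier ?L" for c A
    using that smult_closed[of c A] by (simp add: ring_of_type_algebra_def)
  have closed: "mat_superbracket A B \<in> carrier ?L" if AB: "A \<in> carrier ?L" "B \<in> carrier ?L" for A B
  proof -
    obtain A0 A1 where A: "A = A0 + A1" "A0 \<in> part ?L 0" "A1 \<in> part ?L 1"
      using AB(1) by (auto simp: osp12_def)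
    obtain B0 B1 where B: "B = B0 + B1" "B0 \<in> part ?L 0" "B1 \<in> part ?L 1"
      using AB(2) by (auto simp: osp12_def)
    have "mat_superbracket S T \<in> carrier ?L" if "S \<in> part ?L p" "T \<in> part ?L q" for S T p q
      using that osp12_bracket_parity part_sub by fastforce
    moreover have "S + T \<in> carrier ?L" if "S \<in> carrier ?L" "T \<in> carrier ?L" for S T
      using that a_closed[of S T] by simp
    ultimately show ?thesis
      unfolding A B mat_superbracket_linear using A B by meson
  qed
  show ?thesis
  proof (intro lie_superalgebra.intro lie_superalgebra_axioms.intro osp12_superspace)
    fix A B :: "'k^3^3" and p q
    show "(\<lambda>A. bracket ?L A B) \<in> linear_maps ?L ?L" if "B \<in> carrier ?L"
      using that by (simp add: linear_maps_def hom_def closed mat_superbracket_linear)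
    show "bracket ?L A \<in> linear_maps ?L ?L" if "A \<in> carrier ?L"
      using that by (simp add: linear_maps_def hom_def closed mat_superbracket_linear)
    assume AB: "A \<in> part ?L p" "B \<in> part ?L q"
    then show "bracket ?L A B \<in> part ?L (p + q)"
      unfolding osp12_simps by (rule osp12_bracket_parity)
    have "mat_superbracket A B = - mat_scale (koszul_sign p q) (mat_superbracket B A)"
      using AB[simplified, THEN osp12_part_component]
      by (cases p; cases q) (simp_all add: mat_superbracket_homogeneous vec_eq_iff mat_scale_def)
    moreover have "mat_scale (koszul_sign p q) (mat_superbracket B A) \<in> carrier ?L"
      using AB part_sub closed scale_closed by blast
    ultimately show "bracket ?L A B = \<ominus>\<^bsub>?L\<^esub> (koszul_sign p q \<odot>\<^bsub>?L\<^esub> bracket ?L B A)"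
      by (simp add: uminus)
    fix C r
    assume "C \<in> part ?L r"
    with AB show "bracket ?L A (bracket ?L B C) = bracket ?L (bracket ?L A B) C
        \<oplus>\<^bsub>?L\<^esub> koszul_sign p q \<odot>\<^bsub>?L\<^esub> bracket ?L B (bracket ?L A C)"
      unfolding osp12_simps by (rule osp12_super_jacobi)
  qed
qed

end

theory Submission
  imports Defs
begin

text \<open>
  The Deligne filtration is \<open>F\<^sup>k = \<Sum>\<^bsub>i-j=k\<^esub> (ker x\<^sup>i\<^sup>+\<^sup>1 \<inter> im x\<^sup>j)\<close>. Injectivity of \<open>x\<^sup>k\<close>
  on \<open>Gr\<^sup>k\<close> holds because \<open>x\<^sup>k u \<in> F\<^sup>-\<^sup>k\<^sup>-\<^sup>1 = x\<^sup>k\<^sup>+\<^sup>1 F\<^sup>k\<^sup>+\<^sup>1\<close> gives \<open>w \<in> F\<^sup>k\<^sup>+\<^sup>1\<close>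
  with \<open>u - x w \<in> ker x\<^sup>k \<subseteq> F\<^sup>k\<^sup>-\<^sup>1\<close>.

  Let \<open>V\<^sub>i = Gr\<^sup>2\<^sup>i\<close>. For \<open>n \<ge> 0\<close> every \<open>v \<in> V\<^sub>n\<close> is uniquely \<open>p + X (T v)\<close> with
  \<open>X\<^sup>2\<^sup>n\<^sup>+\<^sup>1 p = 0\<close> and \<open>T v \<in> V\<^sub>n\<^sub>+\<^sub>1\<close>. An operator \<open>Y\<close> of degree one with \<open>YX + XY = h\<close> must
  kill \<open>p\<close>, so that \<open>Y v = (2n + 2) T v - X Y T v\<close>, and must satisfy
  \<open>Y X\<^sup>2\<^sup>n = X\<^sup>2\<^sup>n Y - 2n X\<^sup>2\<^sup>n\<^sup>-\<^sup>1\<close>, which determines it on \<open>V\<^sub>-\<^sub>n = X\<^sup>2\<^sup>n V\<^sub>n\<close>. These formulas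
  define \<open>Y\<close> by downward recursion. Uniqueness: the difference of two candidates
  anticommutes with \<open>X\<close> and has degree one, hence vanishes by the same recursion. Finally, since
  the super Jacobi identity propagates compatibility with brackets from \<open>X\<close> and \<open>Y\<close> to all of
  \<open>osp(1|2)\<close>, the relations between \<open>h\<close>, \<open>X\<close>, \<open>Y\<close> suffice for a module structure.
\<close>

section \<open>Superspaces, quotients and direct sums\<close>

lemma scalars_simps [simp]:
  "carrier (scalars :: 'k::field ring) = UNIV" "add (scalars :: 'k ring) = (+)"
  "monoid.mult (scalars :: 'k ring) = (*)" "zero (scalars :: 'k ring) = 0" "one (scalars :: 'k ring) = 1"
  by (simp_all add: ring_of_type_algebra_def)

lemma linear_mapsD:
  assumes "f \<in> linear_maps V W" "v \<in> carrier V"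
  shows "f v \<in> carrier W" "u \<in> carrier V \<Longrightarrow> f (v \<oplus>\<^bsub>V\<^esub> u) = f v \<oplus>\<^bsub>W\<^esub> f u"
    "f (c \<odot>\<^bsub>V\<^esub> v) = c \<odot>\<^bsub>W\<^esub> f v"
  using assms by (auto simp: linear_maps_def hom_def)

lemma linear_mapsI:
  assumes "\<And>v. v \<in> carrier V \<Longrightarrow> f v \<in> carrier W"
    "\<And>v u. v \<in> carrier V \<Longrightarrow> u \<in> carrier V \<Longrightarrow> f (v \<oplus>\<^bsub>V\<^esub> u) = f v \<oplus>\<^bsub>W\<^esub> f u"
    "\<And>c v. v \<in> carrier V \<Longrightarrow> f (c \<odot>\<^bsub>V\<^esub> v) = c \<odot>\<^bsub>W\<^esub> f v"
  shows "f \<in> linear_maps V W"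
  using assms by (auto simp: linear_maps_def hom_def)

context superspace
begin

lemma scale_closed [simp, intro]: "v \<in> carrier V \<Longrightarrow> c \<odot> v \<in> carrier V"
  by (rule smult_closed) simp_all

lemma scale_add_left: "v \<in> carrier V \<Longrightarrow> (a + b) \<odot> v = a \<odot> v \<oplus> b \<odot> v"
  using smult_l_distr[of a b v] by simp

lemma scale_add_right: "u \<in> carrier V \<Longrightarrow> v \<in> carrier V \<Longrightarrow> a \<odot> (u \<oplus> v) = a \<odot> u \<oplus> a \<odot> v"
  using smult_r_distr[of a u v] by simp

lemma scale_scale: "v \<in> carrier V \<Longrightarrow> a \<odot> (b \<odot> v) = (a * b) \<odot> v"
  using smult_assoc1[of a b v] by simp

lemma scale_one [simp]: "v \<in> carrier V \<Longrightarrow> 1 \<odot> v = v"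
  using smult_one[of v] by simp

lemma scale_zero_left [simp]: "v \<in> carrier V \<Longrightarrow> 0 \<odot> v = \<zero>"
  using smult_l_null[of v] by simp

lemma scale_zero_right [simp]: "c \<odot> \<zero> = \<zero>"
  using smult_r_null[of c] by simp

lemma scale_minus_left: "v \<in> carrier V \<Longrightarrow> (- c) \<odot> v = \<ominus> (c \<odot> v)"
  by (rule sym, rule minus_equality) (simp_all flip: scale_add_left)

lemma scale_minus_right: "v \<in> carrier V \<Longrightarrow> c \<odot> (\<ominus> v) = \<ominus> (c \<odot> v)"
  using smult_r_minus[of c v] by simp

lemma uminus_eq_scale: "v \<in> carrier V \<Longrightarrow> \<ominus> v = (- 1) \<odot> v"
  by (simp add: scale_minus_left)

lemma minus_eq_scale: "u \<in> carrier V \<Longrightarrow> v \<in> carrier V \<Longrightarrow> u \<ominus> v = u \<oplus> (- 1) \<odot> v"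
  by (simp add: scale_minus_left a_minus_def)

lemma scale_eq_zero_iff: "v \<in> carrier V \<Longrightarrow> c \<odot> v = \<zero> \<longleftrightarrow> c = 0 \<or> v = \<zero>"
proof
  assume v: "v \<in> carrier V" and z: "c \<odot> v = \<zero>"
  have "c \<noteq> 0 \<Longrightarrow> v = (inverse c * c) \<odot> v" using v by simp
  then show "c = 0 \<or> v = \<zero>" using v z by (metis scale_scale scale_zero_right)
qed auto

lemma minus_zero [simp]: "v \<in> carrier V \<Longrightarrow> v \<ominus> \<zero> = v"
  by (simp add: minus_eq_scale)

lemma minus_eq_zero_iff: "u \<in> carrier V \<Longrightarrow> v \<in> carrier V \<Longrightarrow> u \<ominus> v = \<zero> \<longleftrightarrow> u = v"
  by (simp add: M.add.inv_solve_right' a_minus_def)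

lemma add_left_commute_cancel:
  "u \<in> carrier V \<Longrightarrow> v \<in> carrier V \<Longrightarrow> v \<oplus> (u \<ominus> v) = u"
  by (simp add: a_minus_def M.add.m_lcomm M.r_neg)

lemma submoduleD:
  assumes "submodule H scalars V"
  shows "v \<in> H \<Longrightarrow> v \<in> carrier V" "\<zero> \<in> H" "u \<in> H \<Longrightarrow> v \<in> H \<Longrightarrow> u \<oplus> v \<in> H"
    "v \<in> H \<Longrightarrow> c \<odot> v \<in> H" "v \<in> H \<Longrightarrow> \<ominus> v \<in> H" "u \<in> H \<Longrightarrow> v \<in> H \<Longrightarrow> u \<ominus> v \<in> H"
proof -
  note E = submoduleE[OF assms]
  show "v \<in> H \<Longrightarrow> v \<in> carrier V" using E(1) by auto
  show "u \<in> H \<Longrightarrow> v \<in> H \<Longrightarrow> u \<oplus> v \<in> H" by (rule E(5))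
  show s: "v \<in> H \<Longrightarrow> c \<odot> v \<in> H" for v c by (rule E(4)) simp_all
  show "v \<in> H \<Longrightarrow> \<ominus> v \<in> H" by (rule E(3))
  show "u \<in> H \<Longrightarrow> v \<in> H \<Longrightarrow> u \<ominus> v \<in> H" by (simp add: a_minus_def E(3) E(5))
  obtain w where "w \<in> H" using E(2) by blast
  then have "0 \<odot> w \<in> H" "0 \<odot> w = \<zero>" using s E(1) by auto
  then show "\<zero> \<in> H" by simp
qed

lemma submoduleI':
  assumes "H \<subseteq> carrier V" "\<zero> \<in> H" "\<And>u v. u \<in> H \<Longrightarrow> v \<in> H \<Longrightarrow> u \<oplus> v \<in> H"
    "\<And>c v. v \<in> H \<Longrightarrow> c \<odot> v \<in> H"
  shows "submodule H scalars V"
proof (rule submoduleI)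
  show "\<ominus> v \<in> H" if "v \<in> H" for v
    using that assms(1) assms(4)[of v "-1"] by (auto simp: uminus_eq_scale)
qed (use assms in auto)

lemmas partD = submoduleD[OF part_submodule]

text \<open>The two components are returned as one function of the parity, so that later arguments
  can speak of the component of parity \<open>p\<close> for a variable \<open>p\<close>.\<close>

lemma parity_decomposition:
  assumes "v \<in> carrier V"
  obtains w where "\<And>p. w p \<in> part V p" "v = w 0 \<oplus> w 1"
proof -
  obtain a b where ab: "a \<in> part V 0" "b \<in> part V 1" "v = a \<oplus> b"
    using assms unfolding part_sum[symmetric] by (auto simp: set_add_def')
  have "(if p = 0 then a else b) \<in> part V p" for p
    using ab by (cases p) auto
  with ab show thesis using that[of "\<lambda>p. if p = 0 then a else b"] by simp
qed

lemma part_disjoint: "v \<in> part V p \<Longrightarrow> v \<in> part V (p + 1) \<Longrightarrow> v = \<zero>"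
  using part_Int by (cases p) auto

text \<open>The vector \<open>a - c = d - b\<close> lies in both the even and the odd part, hence is
  zero.\<close>

lemma parity_decomposition_unique:
  assumes "a \<in> part V 0" "b \<in> part V 1" "c \<in> part V 0" "d \<in> part V 1" "a \<oplus> b = c \<oplus> d"
  shows "a = c \<and> b = d"
proof -
  note cl = assms(1-4)[THEN partD(1)]
  have "a \<ominus> c = d \<ominus> b"
  proof -
    have "a = c \<oplus> d \<ominus> b"
      using cl assms(5) by (metis M.add.inv_solve_right M.add.m_closed a_minus_def)
    also have "\<dots> = c \<oplus> (d \<ominus> b)" using cl by (simp add: a_minus_def M.add.m_assoc)
    finally show ?thesis using cl
      by (metis M.add.inv_solve_right' M.add.m_comm M.minus_closed a_minus_def)
  qed
  moreover have "a \<ominus> c \<in> part V 0" "d \<ominus> b \<in> part V 1" using assms by (auto intro: partD)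
  ultimately have "a \<ominus> c = \<zero>" "d \<ominus> b = \<zero>" using part_disjoint[of _ 0] by auto
  then show ?thesis using cl minus_eq_zero_iff by metis
qed

text \<open>Replaces the set equation in the definition by a condition on the homogeneous components
  of single elements. Later verifications produce this form, and \<open>subsuperspaceD\<close> gives
  it back.\<close>

lemma subsuperspaceI:
  assumes "submodule W scalars V"
    and "\<And>a b. a \<in> part V 0 \<Longrightarrow> b \<in> part V 1 \<Longrightarrow> a \<oplus> b \<in> W \<Longrightarrow> a \<in> W \<and> b \<in> W"
  shows "subsuperspace W V"
  unfolding subsuperspace_def
proof (intro conjI assms(1) equalityI subsetI)
  fix v assume v: "v \<in> W"
  then obtain w where w: "\<And>p. w p \<in> part V p" "v = w 0 \<oplus> w 1"
    using parity_decomposition submoduleD(1)[OF assms(1)] by blast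
  then show "v \<in> (W \<inter> part V 0) <+> (W \<inter> part V 1)"
    using assms(2)[of "w 0" "w 1"] v by (auto simp: set_add_def')
qed (auto simp: set_add_def' intro: submoduleD[OF assms(1)])

lemma subsuperspaceD:
  assumes "subsuperspace W V"
  shows "submodule W scalars V"
    and "a \<in> part V 0 \<Longrightarrow> b \<in> part V 1 \<Longrightarrow> a \<oplus> b \<in> W \<Longrightarrow> a \<in> W \<and> b \<in> W"
proof -
  show "submodule W scalars V" using assms by (simp add: subsuperspace_def)
  assume ab: "a \<in> part V 0" "b \<in> part V 1" and "a \<oplus> b \<in> W"
  then have "a \<oplus> b \<in> (W \<inter> part V 0) <+> (W \<inter> part V 1)"
    using assms by (simp add: subsuperspace_def)
  then obtain c d where "c \<in> W" "c \<in> part V 0" "d \<in> W" "d \<in> part V 1" "a \<oplus> b = c \<oplus> d"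
    by (auto simp: set_add_def')
  then show "a \<in> W \<and> b \<in> W" using parity_decomposition_unique[OF ab, of c d] by auto
qed

end

section \<open>Rearranging differences in superspaces\<close>

context superspace
begin

lemma add_uminus_eq_minus: "a \<oplus> \<ominus> b = a \<ominus> b"
  by (simp add: a_minus_def)

lemma uminus_add_eq_minus: "\<lbrakk>a \<in> carrier V; b \<in> carrier V\<rbrakk> \<Longrightarrow> \<ominus> a \<oplus> b = b \<ominus> a"
  by (simp add: a_minus_def M.a_comm)

lemma minus_uminus_eq_add: "\<lbrakk>a \<in> carrier V; b \<in> carrier V\<rbrakk> \<Longrightarrow> a \<ominus> \<ominus> b = a \<oplus> b"
  by (simp add: a_minus_def)

lemma minus_eq_iff: "\<lbrakk>a \<in> carrier V; b \<in> carrier V; c \<in> carrier V\<rbrakk> \<Longrightarrow> a \<ominus> b = c \<longleftrightarrow> a = c \<oplus> b"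
  by (metis M.add.inv_solve_right' a_minus_def)

lemma eq_minus_iff: "\<lbrakk>a \<in> carrier V; b \<in> carrier V; c \<in> carrier V\<rbrakk> \<Longrightarrow> a = c \<ominus> b \<longleftrightarrow> a \<oplus> b = c"
  by (metis minus_eq_iff)

lemma uminus_eq_iff: "\<lbrakk>a \<in> carrier V; b \<in> carrier V\<rbrakk> \<Longrightarrow> \<ominus> a = b \<longleftrightarrow> \<zero> = a \<oplus> b"
  by (metis M.minus_equality M.r_neg M.a_comm)

lemma add_minus_assoc:
  "\<lbrakk>a \<in> carrier V; b \<in> carrier V; c \<in> carrier V\<rbrakk> \<Longrightarrow> a \<oplus> (b \<ominus> c) = (a \<oplus> b) \<ominus> c"
  "\<lbrakk>a \<in> carrier V; b \<in> carrier V; c \<in> carrier V\<rbrakk> \<Longrightarrow> (a \<ominus> b) \<oplus> c = (a \<oplus> c) \<ominus> b"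
  "\<lbrakk>a \<in> carrier V; b \<in> carrier V; c \<in> carrier V\<rbrakk> \<Longrightarrow> a \<ominus> (b \<ominus> c) = (a \<oplus> c) \<ominus> b"
  "\<lbrakk>a \<in> carrier V; b \<in> carrier V; c \<in> carrier V\<rbrakk> \<Longrightarrow> (a \<ominus> b) \<ominus> c = a \<ominus> (b \<oplus> c)"
  by (simp_all add: a_minus_def M.minus_add M.a_ac)

lemma minus_add_minus:
  "\<lbrakk>a \<in> carrier V; b \<in> carrier V; c \<in> carrier V; d \<in> carrier V\<rbrakk> \<Longrightarrow>
    (a \<oplus> b) \<ominus> (c \<oplus> d) = (a \<ominus> c) \<oplus> (b \<ominus> d)"
  by (simp add: a_minus_def M.minus_add M.a_ac)

lemma scale_diff: "\<lbrakk>a \<in> carrier V; b \<in> carrier V\<rbrakk> \<Longrightarrow> r \<odot> (a \<ominus> b) = r \<odot> a \<ominus> r \<odot> b"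
  by (simp add: a_minus_def scale_add_right scale_minus_right)

lemma scale_two: "v \<in> carrier V \<Longrightarrow> 2 \<odot> v = v \<oplus> v"
  using scale_add_left[of v 1 1] by simp

lemma scale_four: "v \<in> carrier V \<Longrightarrow> 4 \<odot> v = (v \<oplus> v) \<oplus> (v \<oplus> v)"
  using scale_add_left[of v 2 2] by (simp add: scale_two)

lemma scale_linear: "(\<odot>) c \<in> linear_maps V V"
  by (rule linear_mapsI) (simp_all add: scale_add_right scale_scale mult.commute)

text \<open>Moves every subtracted term to the other side of an equation and expands scaling, so
  that an identity with differences becomes an identity between sums that associativity and
  commutativity decide.\<close>

lemmas diff_simps = add_uminus_eq_minus uminus_add_eq_minus minus_uminus_eq_add minus_eq_iff eq_minus_iff
  uminus_eq_iff add_minus_assoc scale_diff scale_minus_left scale_minus_right scale_add_right M.a_ac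

end

lemma linear_maps_zero:
  assumes "superspace V" "superspace W" "f \<in> linear_maps V W"
  shows "f \<zero>\<^bsub>V\<^esub> = \<zero>\<^bsub>W\<^esub>"
proof -
  interpret V: superspace V by fact
  interpret W: superspace W by fact
  have "f (0 \<odot>\<^bsub>V\<^esub> \<zero>\<^bsub>V\<^esub>) = 0 \<odot>\<^bsub>W\<^esub> f \<zero>\<^bsub>V\<^esub>" using linear_mapsD(3)[OF assms(3)] by blast
  moreover have "f \<zero>\<^bsub>V\<^esub> \<in> carrier W" using linear_mapsD(1)[OF assms(3)] by blast
  ultimately show ?thesis by simp
qed

lemma linear_maps_minus:
  assumes "superspace V" "superspace W" "f \<in> linear_maps V W" "u \<in> carrier V" "v \<in> carrier V"
  shows "f (u \<ominus>\<^bsub>V\<^esub> v) = f u \<ominus>\<^bsub>W\<^esub> f v"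
proof -
  interpret V: superspace V by fact
  interpret W: superspace W by fact
  show ?thesis using assms(4,5) linear_mapsD[OF assms(3)]
    by (simp add: V.minus_eq_scale W.minus_eq_scale)
qed

lemma linear_maps_funpow: "f \<in> linear_maps V V \<Longrightarrow> f ^^ n \<in> linear_maps V V"
  by (induction n) (auto intro!: linear_mapsI simp: linear_mapsD)


section \<open>Cosets and quotient superspaces\<close>

context superspace
begin

lemma subsuperspace_abelian_subgroup:
  assumes "subsuperspace W V"
  shows "abelian_subgroup W V"
  using subsuperspaceD(1)[OF assms]
  by (intro abelian_subgroupI3 additive_subgroup.intro M.abelian_group_axioms) (rule submodule.axioms)

lemma coset_eq_iff:
  assumes "subsuperspace W V" "u \<in> carrier V" "v \<in> carrier V"
  shows "W +> u = W +> v \<longleftrightarrow> u \<ominus> v \<in> W"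
proof -
  interpret W: abelian_subgroup W V by (rule subsuperspace_abelian_subgroup) fact
  show ?thesis using assms(2,3)
    by (metis W.a_rcos_module W.a_rcos_self W.a_repr_independence' a_minus_def)
qed

lemma coset_self:
  assumes "subsuperspace W V" "v \<in> carrier V"
  shows "v \<in> W +> v"
proof -
  interpret W: abelian_subgroup W V by (rule subsuperspace_abelian_subgroup) fact
  show ?thesis using W.a_rcos_self assms(2) .
qed

lemma coset_memD:
  assumes "subsuperspace W V" "v \<in> carrier V" "u \<in> W +> v"
  shows "u \<in> carrier V" "u \<ominus> v \<in> W"
proof -
  interpret W: abelian_subgroup W V by (rule subsuperspace_abelian_subgroup) fact
  show u: "u \<in> carrier V" using W.a_elemrcos_carrier assms(2,3) .
  show "u \<ominus> v \<in> W" using assms(2,3) u W.a_rcos_module a_minus_def by metis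
qed

text \<open>Operations on cosets, namely scaling in \<open>quotient\<close> and the induced map
  \<open>Gr_map\<close>, are encoded as unions over all representatives. This evaluates such a union
  at one representative once independence of the choice is known.\<close>

lemma UN_coset:
  assumes W: "subsuperspace W V" and v: "v \<in> carrier V"
    and const: "\<And>u. u \<in> carrier V \<Longrightarrow> u \<ominus> v \<in> W \<Longrightarrow> g u = g v"
  shows "(\<Union>u\<in>W +> v. g u) = g v"
  using coset_self[OF W v] coset_memD[OF W v] const by blast

lemma coset_add:
  assumes "subsuperspace W V" "u \<in> carrier V" "v \<in> carrier V"
  shows "(W +> u) <+> (W +> v) = W +> (u \<oplus> v)"
proof -
  interpret W: abelian_subgroup W V by (rule subsuperspace_abelian_subgroup) fact
  show ?thesis using W.a_rcos_sum assms(2,3) .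
qed

lemma coset_scale:
  assumes "subsuperspace W V" "v \<in> carrier V"
  shows "(\<Union>u\<in>W +> v. W +> (c \<odot> u)) = W +> (c \<odot> v)"
proof (rule UN_coset[OF assms])
  fix u assume u: "u \<in> carrier V" "u \<ominus> v \<in> W"
  have "c \<odot> u \<ominus> c \<odot> v = c \<odot> (u \<ominus> v)"
    using u(1) assms(2) by (simp add: a_minus_def scale_add_right scale_minus_right)
  then show "W +> (c \<odot> u) = W +> (c \<odot> v)"
    using u assms submoduleD(4)[OF subsuperspaceD(1)[OF assms(1)]] by (simp add: coset_eq_iff)
qed

lemma quotient_simps:
  "carrier (quotient V W) = (+>) W ` carrier V" "\<zero>\<^bsub>quotient V W\<^esub> = W"
  "part (quotient V W) p = (+>) W ` part V p"
  by (auto simp: quotient_def A_RCOSETS_def')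

lemma quotient_ops:
  assumes "subsuperspace W V" "u \<in> carrier V"
  shows "v \<in> carrier V \<Longrightarrow> (W +> u) \<oplus>\<^bsub>quotient V W\<^esub> (W +> v) = W +> (u \<oplus> v)"
    "c \<odot>\<^bsub>quotient V W\<^esub> (W +> u) = W +> (c \<odot> u)"
  using coset_add[OF assms] coset_scale[OF assms] by (simp_all add: quotient_def)

lemma coset_zero: "subsuperspace W V \<Longrightarrow> W +> \<zero> = W"
  using submoduleD(1)[OF subsuperspaceD(1)] by (simp add: a_coset_add_zero subsetI)

lemma superspace_quotient:
  assumes W: "subsuperspace W V"
  shows "superspace (quotient V W)"
proof -
  let ?Q = "quotient V W"
  note [simp] = quotient_simps quotient_ops[OF W]
  note sub = submoduleD[OF subsuperspaceD(1)[OF W]]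
  have zero: "W = W +> \<zero>" using coset_zero[OF W] by simp
  have mod: "module scalars ?Q"
  proof (rule moduleI[OF cring_from_type_algebra])
    show "abelian_group ?Q"
    proof (rule abelian_groupI)
      show "\<zero>\<^bsub>?Q\<^esub> \<in> carrier ?Q" using zero by auto
      show "\<zero>\<^bsub>?Q\<^esub> \<oplus>\<^bsub>?Q\<^esub> A = A" if "A \<in> carrier ?Q" for A
        using that zero quotient_ops(1)[OF W M.zero_closed] by auto
      show "\<exists>B\<in>carrier ?Q. B \<oplus>\<^bsub>?Q\<^esub> A = \<zero>\<^bsub>?Q\<^esub>" if "A \<in> carrier ?Q" for A
      proof -
        from that obtain v where v: "v \<in> carrier V" "A = W +> v" by auto
        then have "(W +> (\<ominus> v)) \<oplus>\<^bsub>?Q\<^esub> A = \<zero>\<^bsub>?Q\<^esub>" using zero by (simp add: M.l_neg)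
        then show ?thesis using v by force
      qed
    qed (auto simp: M.a_ac)
  qed (auto simp: scale_add_left scale_add_right scale_scale)
  interpret Q: module scalars ?Q by (rule mod)
  have uminus: "\<ominus>\<^bsub>?Q\<^esub> (W +> v) = W +> (\<ominus> v)" if "v \<in> carrier V" for v
    using that zero by (intro Q.minus_equality) (auto simp: M.l_neg)
  show ?thesis
  proof (intro superspace.intro superspace_axioms.intro mod)
    show "submodule (part ?Q p) scalars ?Q" for p
    proof (rule Q.submoduleI)
      show "\<zero>\<^bsub>?Q\<^esub> \<in> part ?Q p" using zero partD(2)[of p] by auto
    qed (auto simp: uminus partD)
    show "part ?Q 0 <+>\<^bsub>?Q\<^esub> part ?Q 1 = carrier ?Q"
    proof (intro equalityI subsetI)
      fix A assume "A \<in> carrier ?Q"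
      then obtain v where v: "v \<in> carrier V" "A = W +> v" by auto
      then obtain w where w: "\<And>p. w p \<in> part V p" "v = w 0 \<oplus> w 1"
        using parity_decomposition by blast
      have "A = (W +> w 0) \<oplus>\<^bsub>?Q\<^esub> (W +> w 1)" using v w by (simp add: partD(1)[OF w(1)])
      then show "A \<in> part ?Q 0 <+>\<^bsub>?Q\<^esub> part ?Q 1" using w(1) by (auto simp: set_add_def')
    qed (auto simp: set_add_def' partD)
    show "part ?Q 0 \<inter> part ?Q 1 = {\<zero>\<^bsub>?Q\<^esub>}"
    proof (intro equalityI subsetI)
      fix A assume "A \<in> part ?Q 0 \<inter> part ?Q 1"
      then obtain a b where ab: "a \<in> part V 0" "b \<in> part V 1" "A = W +> a" "W +> a = W +> b" by auto
      \<comment> \<open>A coset with an even and an odd representative: \<open>a\<close> and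
        \<open>- b\<close> are the homogeneous components of an element of the graded subspace
        \<open>W\<close>, so \<open>a\<close> itself lies in \<open>W\<close>.\<close>
      have "a \<oplus> \<ominus> b \<in> W"
        using ab coset_eq_iff[OF W] partD(1) by (simp add: a_minus_def)
      then have "a \<in> W" using subsuperspaceD(2)[OF W ab(1) partD(5)[OF ab(2)]] by simp
      then have "W +> a = W +> \<zero>" using coset_eq_iff[OF W] sub(1) sub(6)[OF _ sub(2)] by simp
      then show "A \<in> {\<zero>\<^bsub>?Q\<^esub>}" using ab zero by simp
    qed (use zero partD(2) in auto)
  qed
qed

section \<open>Graded subspaces as superspaces\<close>

lemma restrict_to_simps [simp]:
  "carrier (restrict_to V W) = W" "\<zero>\<^bsub>restrict_to V W\<^esub> = \<zero>" "add (restrict_to V W) = add V"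
  "module.smult (restrict_to V W) = module.smult V" "part (restrict_to V W) p = W \<inter> part V p"
  "(+>\<^bsub>restrict_to V W\<^esub>) = (+>)"
  by (simp_all add: restrict_to_def a_r_coset_def r_coset_def fun_eq_iff)

lemma superspace_restrict_to:
  assumes W: "subsuperspace W V"
  shows "superspace (restrict_to V W)"
proof -
  note sub = submoduleD[OF subsuperspaceD(1)[OF W]]
  let ?U = "restrict_to V W"
  have mod: "module scalars ?U"
  proof (rule moduleI[OF cring_from_type_algebra])
    show "abelian_group ?U"
    proof (rule abelian_groupI)
      show "\<exists>b\<in>carrier ?U. b \<oplus>\<^bsub>?U\<^esub> a = \<zero>\<^bsub>?U\<^esub>" if "a \<in> carrier ?U" for a
        using that sub(1,5)[of a] by (intro bexI[of _ "\<ominus> a"]) (auto simp: M.l_neg)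
    qed (auto simp: M.a_ac sub)
  qed (auto simp: scale_add_left scale_add_right scale_scale sub)
  interpret U: module scalars ?U by (rule mod)
  have uminus: "\<ominus>\<^bsub>?U\<^esub> v = \<ominus> v" if "v \<in> W" for v
    using that sub by (intro U.minus_equality) (auto simp: M.l_neg)
  show ?thesis
  proof (intro superspace.intro superspace_axioms.intro mod)
    show "submodule (part ?U p) scalars ?U" for p
      by (rule U.submoduleI) (auto simp: uminus partD sub)
    show "part ?U 0 <+>\<^bsub>?U\<^esub> part ?U 1 = carrier ?U"
      using W by (simp add: subsuperspace_def set_add_def set_mult_def)
    show "part ?U 0 \<inter> part ?U 1 = {\<zero>\<^bsub>?U\<^esub>}"
      using part_Int sub(2) by auto
  qed
qed

lemma subsuperspace_restrict_to:
  assumes W: "subsuperspace W V" and U: "subsuperspace U V" and "W \<subseteq> U"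
  shows "subsuperspace W (restrict_to V U)"
proof -
  interpret U: superspace "restrict_to V U" by (rule superspace_restrict_to) fact
  note sub = submoduleD[OF subsuperspaceD(1)[OF W]]
  show ?thesis
  proof (rule U.subsuperspaceI)
    show "submodule W scalars (restrict_to V U)"
      using sub assms(3) by (intro U.submoduleI') auto
    show "a \<in> W \<and> b \<in> W" if "a \<in> part (restrict_to V U) 0" "b \<in> part (restrict_to V U) 1"
      "a \<oplus>\<^bsub>restrict_to V U\<^esub> b \<in> W" for a b
      using subsuperspaceD(2)[OF W] that by auto
  qed
qed

end

section \<open>Direct sums of superspaces\<close>

lemma direct_sum_simps:
  "u \<in> carrier (direct_sum V) \<longleftrightarrow>
    (\<forall>i. u i \<in> carrier (V i)) \<and> finite {i. u i \<noteq> \<zero>\<^bsub>V i\<^esub>}"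
  "u \<in> part (direct_sum V) p \<longleftrightarrow>
    (\<forall>i. u i \<in> part (V i) p) \<and> finite {i. u i \<noteq> \<zero>\<^bsub>V i\<^esub>}"
  "\<zero>\<^bsub>direct_sum V\<^esub> = (\<lambda>i. \<zero>\<^bsub>V i\<^esub>)"
  "u \<oplus>\<^bsub>direct_sum V\<^esub> w = (\<lambda>i. u i \<oplus>\<^bsub>V i\<^esub> w i)"
  "c \<odot>\<^bsub>direct_sum V\<^esub> u = (\<lambda>i. c \<odot>\<^bsub>V i\<^esub> u i)"
  by (simp_all add: direct_sum_def)

lemma superspace_direct_sum:
  fixes V :: "'i \<Rightarrow> ('k::field, 'v) superspace"
  assumes "\<And>i. superspace (V i)"
  shows "superspace (direct_sum V)"
proof -
  let ?D = "direct_sum V"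
  interpret V: superspace "V i" for i by fact
  \<comment> \<open>Each family formed below vanishes wherever its arguments do, so its support lies
    in the union of theirs; all finiteness claims reduce to this.\<close>
  have fin: "finite {i. h i \<noteq> \<zero>\<^bsub>V i\<^esub>}"
    if "finite {i. f i \<noteq> \<zero>\<^bsub>V i\<^esub>}" "finite {i. g i \<noteq> \<zero>\<^bsub>V i\<^esub>}"
      "\<And>i. f i = \<zero>\<^bsub>V i\<^esub> \<Longrightarrow> g i = \<zero>\<^bsub>V i\<^esub> \<Longrightarrow> h i = \<zero>\<^bsub>V i\<^esub>" for f g h
    by (rule finite_subset[OF _ finite_UnI[OF that(1,2)]]) (use that(3) in blast)
  note [simp] = direct_sum_simps
  have mod: "module scalars ?D"
  proof (rule moduleI[OF cring_from_type_algebra])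
    show "abelian_group ?D"
    proof (rule abelian_groupI)
      show "u \<oplus>\<^bsub>?D\<^esub> w \<in> carrier ?D" if "u \<in> carrier ?D" "w \<in> carrier ?D" for u w
        using that by (auto intro: fin[of u w])
      show "\<exists>w\<in>carrier ?D. w \<oplus>\<^bsub>?D\<^esub> u = \<zero>\<^bsub>?D\<^esub>" if "u \<in> carrier ?D" for u
        using that by (intro bexI[of _ "\<lambda>i. \<ominus>\<^bsub>V i\<^esub> u i"]) (auto simp: V.M.l_neg intro: fin[of u u])
    qed (auto simp: V.M.a_ac)
    show "c \<odot>\<^bsub>?D\<^esub> u \<in> carrier ?D" if "u \<in> carrier ?D" for c u
      using that by (auto intro: fin[of u u])
  qed (auto simp: V.scale_add_left V.scale_add_right V.scale_scale)
  interpret D: module scalars ?D by (rule mod)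
  have uminus: "\<ominus>\<^bsub>?D\<^esub> u = (\<lambda>i. \<ominus>\<^bsub>V i\<^esub> u i)" if "u \<in> carrier ?D" for u
    using that by (intro D.minus_equality) (auto simp: V.M.l_neg intro: fin[of u u])
  have part: "u \<in> carrier ?D" if "u \<in> part ?D p" for u p
    using that by (auto intro: V.partD(1))
  show ?thesis
  proof (intro superspace.intro superspace_axioms.intro mod)
    show "submodule (part ?D p) scalars ?D" for p
    proof (rule D.submoduleI)
      show "part ?D p \<subseteq> carrier ?D" using part by blast
      show "\<ominus>\<^bsub>?D\<^esub> u \<in> part ?D p" if "u \<in> part ?D p" for u
        unfolding uminus[OF part[OF that]] using that by (auto intro: V.partD fin[of u u])
      show "u \<oplus>\<^bsub>?D\<^esub> w \<in> part ?D p" if "u \<in> part ?D p" "w \<in> part ?D p" for u w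
        using that by (auto intro: V.partD fin[of u w])
      show "c \<odot>\<^bsub>?D\<^esub> u \<in> part ?D p" if "u \<in> part ?D p" for c u
        using that by (auto intro: V.partD fin[of u u])
    qed (auto intro: V.partD)
    show "part ?D 0 <+>\<^bsub>?D\<^esub> part ?D 1 = carrier ?D"
    proof (intro equalityI subsetI)
      fix u assume u: "u \<in> carrier ?D"
      have "\<exists>w. (\<forall>p. w p \<in> part (V i) p) \<and> u i = w 0 \<oplus>\<^bsub>V i\<^esub> w 1" for i
      proof -
        have "u i \<in> carrier (V i)" using u by simp
        then show ?thesis by (rule V.parity_decomposition) blast
      qed
      then obtain w where w: "\<And>i p. w i p \<in> part (V i) p" "\<And>i. u i = w i 0 \<oplus>\<^bsub>V i\<^esub> w i 1"
        by metis
      \<comment> \<open>The components were chosen separately for each \<open>i\<close>. Uniqueness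
        of the decomposition makes both vanish where \<open>u\<close> does, which keeps their
        supports finite.\<close>
      have "w i 0 = \<zero>\<^bsub>V i\<^esub> \<and> w i 1 = \<zero>\<^bsub>V i\<^esub>" if "u i = \<zero>\<^bsub>V i\<^esub>" for i
        using that w by (intro V.parity_decomposition_unique) (auto intro: V.partD)
      then have "(\<lambda>i. w i p) \<in> part ?D p" for p
        using u w(1) by (cases p) (auto intro: fin[of u u])
      then show "u \<in> part ?D 0 <+>\<^bsub>?D\<^esub> part ?D 1"
        unfolding set_add_def' using w(2) by (auto intro!: bexI)
    next
      fix u assume "u \<in> part ?D 0 <+>\<^bsub>?D\<^esub> part ?D 1"
      then show "u \<in> carrier ?D" unfolding set_add_def' using part D.a_closed by blast
    qed
    show "part ?D 0 \<inter> part ?D 1 = {\<zero>\<^bsub>?D\<^esub>}"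
      using V.part_disjoint[of _ _ 0] by (auto simp: fun_eq_iff intro: V.partD)
  qed
qed

section \<open>The Deligne filtration\<close>

lemma bit_add_self: "(p :: bit) + q + q = p"
  by (cases p; cases q) simp_all

section \<open>Filtered superspaces and their graded pieces\<close>

locale super_filtration = superspace M
  for M :: "('k::field, 'm) superspace" (structure) +
  fixes F :: "int \<Rightarrow> 'm set"
  assumes sub: "subsuperspace (F i) M"
    and step: "F i \<subseteq> F (i + 1)"
begin

lemmas FD = submoduleD[OF subsuperspaceD(1)[OF sub]]

lemma step': "F (i - 1) \<subseteq> F i"
  using step[of "i - 1"] by simp

lemma mono: "i \<le> j \<Longrightarrow> F i \<subseteq> F j"
proof (induction j rule: int_ge_induct)
  case (step j)
  then show ?case using super_filtration.step[OF super_filtration_axioms, of j] by simp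
qed simp

lemma Gr_superspace: "superspace (Gr M F i)"
  unfolding Gr_def
  by (intro superspace.superspace_quotient superspace_restrict_to subsuperspace_restrict_to sub step')

lemma Gr_simps:
  "carrier (Gr M F i) = (+>) (F (i - 1)) ` F i"
  "\<zero>\<^bsub>Gr M F i\<^esub> = F (i - 1)"
  "part (Gr M F i) p = (+>) (F (i - 1)) ` (F i \<inter> part M p)"
  by (simp_all add: Gr_def superspace.quotient_simps superspace_restrict_to sub)

lemma Gr_ops:
  assumes "u \<in> F i"
  shows "v \<in> F i \<Longrightarrow> (F (i - 1) +> u) \<oplus>\<^bsub>Gr M F i\<^esub> (F (i - 1) +> v) = F (i - 1) +> (u \<oplus> v)"
    "c \<odot>\<^bsub>Gr M F i\<^esub> (F (i - 1) +> u) = F (i - 1) +> (c \<odot> u)"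
  using superspace.quotient_ops[OF superspace_restrict_to[OF sub] subsuperspace_restrict_to[OF sub sub step'],
    of u i] assms by (simp_all add: Gr_def)

text \<open>Two representatives differ by an element of \<open>F (i - 1)\<close>, which
  \<open>f\<close> sends into \<open>F (j - 1)\<close>, so the coset of the image does not depend on
  the representative.\<close>

lemma Gr_map_coset:
  assumes f: "f \<in> linear_maps M M" and F: "f ` F (i - 1) \<subseteq> F (j - 1)" and v: "v \<in> carrier M"
  shows "Gr_map M F f j (F (i - 1) +> v) = F (j - 1) +> f v"
  unfolding Gr_map_def
proof (rule UN_coset[OF sub v])
  fix u assume u: "u \<in> carrier M" "u \<ominus> v \<in> F (i - 1)"
  then have "f u \<ominus> f v \<in> F (j - 1)"
    using F linear_maps_minus[OF superspace_axioms superspace_axioms f u(1) v] by auto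
  then show "F (j - 1) +> f u = F (j - 1) +> f v"
    using coset_eq_iff[OF sub] linear_mapsD(1)[OF f] u v by simp
qed

lemma Gr_map_linear:
  assumes f: "f \<in> linear_maps M M" and F: "f ` F (i - 1) \<subseteq> F (j - 1)" "f ` F i \<subseteq> F j"
  shows "Gr_map M F f j \<in> linear_maps (Gr M F i) (Gr M F j)"
proof (rule linear_mapsI)
  note [simp] = Gr_map_coset[OF f F(1) FD(1)[of _ i]] Gr_simps Gr_ops linear_mapsD[OF f FD(1)[of _ i]]
  have [simp]: "u \<in> F i \<Longrightarrow> f u \<in> F j" for u using F(2) by auto
  show "Gr_map M F f j A \<in> carrier (Gr M F j)" if "A \<in> carrier (Gr M F i)" for A
    using that by auto
  show "Gr_map M F f j (A \<oplus>\<^bsub>Gr M F i\<^esub> B) = Gr_map M F f j A \<oplus>\<^bsub>Gr M F j\<^esub> Gr_map M F f j B"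
    if "A \<in> carrier (Gr M F i)" "B \<in> carrier (Gr M F i)" for A B
    using that by (auto simp: FD)
  show "Gr_map M F f j (c \<odot>\<^bsub>Gr M F i\<^esub> A) = c \<odot>\<^bsub>Gr M F j\<^esub> Gr_map M F f j A"
    if "A \<in> carrier (Gr M F i)" for c A
    using that by (auto simp: FD)
qed

end

section \<open>Powers of an odd operator\<close>

locale odd_superspace = superspace M
  for M :: "('k::field, 'm) superspace" (structure) +
  fixes x :: "'m \<Rightarrow> 'm"
  assumes odd: "odd_operator M x"
begin

lemma x_linear: "x \<in> linear_maps M M"
  using odd by (simp add: odd_operator_def)

lemma pow_linear: "x ^^ k \<in> linear_maps M M"
  by (rule linear_maps_funpow[OF x_linear])

lemmas pow [simp] = linear_mapsD[OF pow_linear]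

lemma pow_zero [simp]: "(x ^^ k) \<zero> = \<zero>"
  by (rule linear_maps_zero[OF superspace_axioms superspace_axioms pow_linear])

lemma pow_minus [simp]:
  "u \<in> carrier M \<Longrightarrow> v \<in> carrier M \<Longrightarrow> (x ^^ k) (u \<ominus> v) = (x ^^ k) u \<ominus> (x ^^ k) v"
  by (rule linear_maps_minus[OF superspace_axioms superspace_axioms pow_linear])

lemma pow_add: "(x ^^ i) ((x ^^ j) v) = (x ^^ (i + j)) v"
  by (simp add: funpow_add)

lemma pow_part: "v \<in> part M p \<Longrightarrow> (x ^^ k) v \<in> part M (p + of_nat k)"
proof (induction k)
  case (Suc k)
  moreover have "x ` part M (p + of_nat k) \<subseteq> part M (p + of_nat k + 1)"
    using odd unfolding odd_operator_def by blast
  ultimately have "x ((x ^^ k) v) \<in> part M (p + of_nat k + 1)" by blast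
  then show ?case by (simp only: funpow.simps o_apply of_nat_Suc add_ac)
qed (simp only: funpow_0 of_nat_0 add_0_right)

end

section \<open>Construction of the Deligne filtration\<close>

locale odd_nilpotent = odd_superspace M x
  for M :: "('k::field, 'm) superspace" (structure) and x :: "'m \<Rightarrow> 'm" +
  fixes n :: nat
  assumes nilpotent: "v \<in> carrier M \<Longrightarrow> (x ^^ n) v = \<zero>"
begin

lemma nilpotent': "v \<in> carrier M \<Longrightarrow> n \<le> k \<Longrightarrow> (x ^^ k) v = \<zero>"
  using nilpotent[of v] pow_add[of "k - n" n v] by simp

text \<open>The span of the spaces \<open>ker x^(i+1)\<close> intersected with
  \<open>im x^j\<close>, over \<open>i - j = k\<close>. An element of such an intersection is given
  by a preimage \<open>z\<close> under \<open>x^j\<close>. Closing under addition suffices, since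
  the generators are stable under scaling, and every proof by induction has only two cases.\<close>

inductive_set weight :: "int \<Rightarrow> 'm set" for k :: int
  where
    gen: "\<lbrakk>z \<in> carrier M; (x ^^ Suc (i + j)) z = \<zero>; int i - int j = k\<rbrakk> \<Longrightarrow> (x ^^ j) z \<in> weight k"
  | add: "\<lbrakk>u \<in> weight k; v \<in> weight k\<rbrakk> \<Longrightarrow> u \<oplus> v \<in> weight k"

lemma weight_closed: "v \<in> weight k \<Longrightarrow> v \<in> carrier M"
  by (induction rule: weight.induct) auto

lemma weight_scale: "v \<in> weight k \<Longrightarrow> c \<odot> v \<in> weight k"
proof (induction rule: weight.induct)
  case (gen z i j)
  then show ?case using weight.gen[of "c \<odot> z" i j k] by (simp del: funpow.simps)
qed (auto simp: scale_add_right weight_closed weight.add)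

text \<open>The generator with \<open>z = 0\<close>, where \<open>i\<close> and \<open>j\<close> are
  the positive and the negative part of \<open>k\<close>, so that \<open>i - j = k\<close>.\<close>

lemma weight_zero: "\<zero> \<in> weight k"
  using weight.gen[of \<zero> "nat k" "nat (- k)" k] by (simp del: funpow.simps)

lemma weight_decomposition:
  "v \<in> weight k \<Longrightarrow> \<exists>w. (\<forall>p. w p \<in> weight k \<inter> part M p) \<and> v = w 0 \<oplus> w 1"
proof (induction rule: weight.induct)
  case (gen z i j)
  obtain w where w: "\<And>p. w p \<in> part M p" "z = w 0 \<oplus> w 1"
    using parity_decomposition[OF gen(1)] by blast
  note cl = partD(1)[OF w(1)]
  let ?N = "Suc (i + j)"
  have "(x ^^ ?N) (w 0) \<oplus> (x ^^ ?N) (w 1) = \<zero>"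
    using gen(2) cl unfolding w(2) by (simp only: pow)
  moreover have "(x ^^ ?N) (w p) \<in> part M (p + of_nat ?N)" for p by (rule pow_part[OF w(1)])
  \<comment> \<open>The operator \<open>x^N\<close> is homogeneous, so the two images have different
    parities and vanish separately. For even \<open>N\<close> they lie in the even and the odd part
    in this order; for odd \<open>N\<close> the order is reversed and the sum has to be commuted
    first.\<close>
  ultimately have "(x ^^ ?N) (w 0) = \<zero> \<and> (x ^^ ?N) (w 1) = \<zero>"
  proof (cases "of_nat ?N :: bit")
    case zero
    with \<open>\<And>p. (x ^^ ?N) (w p) \<in> part M (p + of_nat ?N)\<close>[of 0]
      \<open>\<And>p. (x ^^ ?N) (w p) \<in> part M (p + of_nat ?N)\<close>[of 1]
      \<open>(x ^^ ?N) (w 0) \<oplus> (x ^^ ?N) (w 1) = \<zero>\<close>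
    show ?thesis by (intro parity_decomposition_unique) (simp_all add: partD del: funpow.simps of_nat_Suc)
  next
    case one
    with \<open>\<And>p. (x ^^ ?N) (w p) \<in> part M (p + of_nat ?N)\<close>[of 0]
      \<open>\<And>p. (x ^^ ?N) (w p) \<in> part M (p + of_nat ?N)\<close>[of 1]
      \<open>(x ^^ ?N) (w 0) \<oplus> (x ^^ ?N) (w 1) = \<zero>\<close>
    have "(x ^^ ?N) (w 1) = \<zero> \<and> (x ^^ ?N) (w 0) = \<zero>"
      using M.a_comm[of "(x ^^ ?N) (w 1)" "(x ^^ ?N) (w 0)"] cl
      by (intro parity_decomposition_unique) (simp_all add: partD del: funpow.simps of_nat_Suc)
    then show ?thesis by simp
  qed
  then have zero: "(x ^^ ?N) (w p) = \<zero>" for p by (cases p) auto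
  have sum: "(x ^^ j) z = (x ^^ j) (w 0) \<oplus> (x ^^ j) (w 1)" using cl w(2) by simp
  \<comment> \<open>Since \<open>x^j\<close> shifts parity by \<open>j\<close>, the component of
    parity \<open>p + j\<close> is the one whose image has parity \<open>p\<close>.\<close>
  define w' where "w' p = (x ^^ j) (w (p + of_nat j))" for p
  have "w' p \<in> weight k" for p
    unfolding w'_def using weight.gen[OF cl zero gen(3)] .
  moreover have "w' p \<in> part M p" for p
    using pow_part[OF w(1)[of "p + of_nat j"], of j] unfolding w'_def bit_add_self .
  moreover have "(x ^^ j) z = w' 0 \<oplus> w' 1"
    using sum cl M.a_comm by (cases "of_nat j :: bit") (auto simp: w'_def)
  ultimately show ?case by blast
next
  case (add u v)
  then obtain w w' where w: "\<And>p. w p \<in> weight k \<inter> part M p" "u = w 0 \<oplus> w 1"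
    "\<And>p. w' p \<in> weight k \<inter> part M p" "v = w' 0 \<oplus> w' 1" by blast
  have cl: "w p \<in> carrier M" "w' p \<in> carrier M" for p using w(1,3) weight_closed by blast+
  have "u \<oplus> v = (w 0 \<oplus> w' 0) \<oplus> (w 1 \<oplus> w' 1)" using cl unfolding w(2,4) by (simp add: M.a_ac)
  moreover have "w p \<oplus> w' p \<in> weight k \<inter> part M p" for p
    using w(1,3) by (auto intro: weight.add partD)
  ultimately show ?case by (intro exI[of _ "\<lambda>p. w p \<oplus> w' p"]) auto
qed

lemma weight_subsuperspace: "subsuperspace (weight k) M"
proof (rule subsuperspaceI)
  show "submodule (weight k) scalars M"
    by (rule submoduleI') (auto intro: weight_closed weight_scale weight_zero weight.add)
  show "a \<in> weight k \<and> b \<in> weight k" if "a \<in> part M 0" "b \<in> part M 1" "a \<oplus> b \<in> weight k" for a b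
    using weight_decomposition[OF that(3)] parity_decomposition_unique[OF that(1,2)] by (metis Int_iff)
qed

lemma weight_step: "weight k \<subseteq> weight (k + 1)"
proof
  show "v \<in> weight (k + 1)" if "v \<in> weight k" for v using that
  proof (induction rule: weight.induct)
    case (gen z i j)
    then have "(x ^^ Suc (Suc i + j)) z = \<zero>" using x_linear linear_maps_zero[OF superspace_axioms superspace_axioms] by simp
    then show ?case using weight.gen[of z "Suc i" j "k + 1"] gen by simp
  qed (rule weight.add)
qed

sublocale weight: super_filtration M weight
  by unfold_locales (rule weight_subsuperspace weight_step)+

text \<open>On a generator \<open>x\<close> turns \<open>(i, j)\<close> into
  \<open>(i - 1, j + 1)\<close> with the same \<open>z\<close> and the same \<open>i + j\<close>. If
  \<open>i = 0\<close> the generator is killed.\<close>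

lemma weight_shift: "v \<in> weight k \<Longrightarrow> x v \<in> weight (k - 2)"
proof (induction rule: weight.induct)
  case (gen z i j)
  show ?case
  proof (cases i)
    case 0
    then show ?thesis using gen weight_zero by simp
  next
    case (Suc i')
    then show ?thesis using gen weight.gen[of z i' "Suc j" "k - 2"] by simp
  qed
next
  case (add u v)
  then show ?case by (simp add: linear_mapsD[OF x_linear] weight_closed weight.add)
qed

lemma weight_shift_pow: "v \<in> weight k \<Longrightarrow> (x ^^ i) v \<in> weight (k - 2 * int i)"
proof (induction i)
  case (Suc i)
  then have "x ((x ^^ i) v) \<in> weight (k - 2 * int i - 2)" by (intro weight_shift)
  then show ?case by (simp add: algebra_simps)
qed simp

text \<open>If \<open>i - j <= - n\<close> then \<open>j >= n\<close>, and already
  \<open>x^j\<close> annihilates \<open>z\<close>.\<close>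

lemma weight_bot: "k \<le> - int n \<Longrightarrow> weight k = {\<zero>}"
proof -
  assume k: "k \<le> - int n"
  have "v = \<zero>" if "v \<in> weight k" for v using that
    by (induction rule: weight.induct) (use k nilpotent' in auto)
  then show ?thesis using weight_zero by auto
qed

lemma weight_top: "int n \<le> k \<Longrightarrow> weight k = carrier M"
proof -
  assume k: "int n \<le> k"
  have "v \<in> weight k" if "v \<in> carrier M" for v
    using weight.gen[OF that, of "nat k" 0 k] nilpotent'[OF that, of "Suc (nat k)"] k
    by (simp del: funpow.simps)
  then show ?thesis using weight_closed by auto
qed

text \<open>A generator \<open>x^j z\<close> with \<open>i - j = - k\<close> has
  \<open>j = k + i\<close>, hence is \<open>x^k\<close> of \<open>x^i z\<close>. The latter is the
  generator with \<open>i\<close> and \<open>j\<close> exchanged, which lies in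
  \<open>weight k\<close>.\<close>

lemma weight_surj: "v \<in> weight (- int k) \<Longrightarrow> \<exists>u\<in>weight (int k). (x ^^ k) u = v"
proof (induction rule: weight.induct)
  case (gen z i j)
  then have j: "j = k + i" by simp
  have "(x ^^ i) z \<in> weight (int k)"
    using weight.gen[of z j i "int k"] gen j by (simp add: add_ac)
  then show ?case using pow_add[of k i z] j by auto
next
  case (add u v)
  then obtain a b where "a \<in> weight (int k)" "(x ^^ k) a = u" "b \<in> weight (int k)" "(x ^^ k) b = v" by blast
  then show ?case by (intro bexI[of _ "a \<oplus> b"]) (auto simp: weight_closed weight.add)
qed

text \<open>For positive \<open>k\<close> such a vector is a generator with \<open>i = k - 1\<close>
  and \<open>j = 0\<close>; for \<open>k = 0\<close> it is zero.\<close>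

lemma weight_ker: "v \<in> carrier M \<Longrightarrow> (x ^^ k) v = \<zero> \<Longrightarrow> v \<in> weight (int k - 1)"
  using weight_zero weight.gen[of v "k - 1" 0 "int k - 1"] by (cases k) auto

lemma weight_inj:
  assumes u: "u \<in> weight (int k)" and "(x ^^ k) u \<in> weight (- int k - 1)"
  shows "u \<in> weight (int k - 1)"
proof -
  have "- int (Suc k) = - int k - 1" by simp
  then obtain w where w: "w \<in> weight (int (Suc k))" "(x ^^ Suc k) w = (x ^^ k) u"
    using weight_surj[of "(x ^^ k) u" "Suc k"] assms(2) by metis
  have xw: "x w \<in> weight (int k - 1)" using weight_shift[OF w(1)] by (simp add: algebra_simps)
  note cl = weight_closed[OF u] weight_closed[OF xw]
  have "(x ^^ k) (u \<ominus> x w) = \<zero>"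
    using w(2) cl by (simp add: funpow_swap1 minus_eq_zero_iff)
  then have "u \<ominus> x w \<in> weight (int k - 1)" using weight_ker cl by simp
  then have "x w \<oplus> (u \<ominus> x w) \<in> weight (int k - 1)" using xw weight.add by blast
  then show ?thesis using add_left_commute_cancel[OF cl] by simp
qed

section \<open>The characterising properties of the filtration and its uniqueness\<close>

lemma funpow_image:
  assumes "\<And>i. x ` F i \<subseteq> F (i - 2)" "v \<in> F i"
  shows "(x ^^ m) v \<in> F (i - 2 * int m)"
proof (induction m)
  case (Suc m)
  then have "x ((x ^^ m) v) \<in> F (i - 2 * int m - 2)" using assms(1) by blast
  then show ?case by (simp add: algebra_simps)
qed (use assms in simp)

lemma weight_deligne: "is_deligne_filtration M x weight"
  unfolding is_deligne_filtration_def
proof (intro conjI allI)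
  show "\<exists>i. weight i = {\<zero>}" using weight_bot by blast
  show "\<exists>i. weight i = carrier M" using weight_top by blast
  fix i show "x ` weight i \<subseteq> weight (i - 2)" using weight_shift by blast
next
  fix i :: nat
  let ?f = "Gr_map M weight (x ^^ i) (- int i)"
  let ?G = "Gr M weight (int i)" and ?H = "Gr M weight (- int i)"
  have "int i - 1 - 2 * int i = - int i - 1" "int i - 2 * int i = - int i" by simp_all
  then have sh: "(x ^^ i) ` weight (int i - 1) \<subseteq> weight (- int i - 1)" "(x ^^ i) ` weight (int i) \<subseteq> weight (- int i)"
    using weight_shift_pow[of _ "int i - 1" i] weight_shift_pow[of _ "int i" i] by auto
  note f [simp] = weight.Gr_map_coset[OF pow_linear sh(1) weight_closed]
  have lin: "?f \<in> linear_maps ?G ?H" by (rule weight.Gr_map_linear[OF pow_linear sh])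
  \<comment> \<open>A preimage of a homogeneous \<open>v\<close> may be replaced by its component of
    parity \<open>p\<close>: the image of the other component is a difference of vectors of parity
    \<open>p + i\<close>, but has parity \<open>p + i + 1\<close>, so it is zero.\<close>
  have surj: "\<exists>u\<in>weight (int i) \<inter> part M p. (x ^^ i) u = v" if v: "v \<in> weight (- int i)" "v \<in> part M (p + of_nat i)" for v p
  proof -
    obtain u where u: "u \<in> weight (int i)" "(x ^^ i) u = v" using weight_surj v by blast
    obtain w where w: "\<And>p. w p \<in> weight (int i) \<inter> part M p" "u = w 0 \<oplus> w 1"
      using weight_decomposition[OF u(1)] by blast
    have cl: "w p \<in> carrier M" for p using w(1) weight_closed by blast
    define q where "q = p + 1"
    have wp: "u = w q \<oplus> w p" using w(2) cl M.a_comm unfolding q_def by (cases p) auto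
    have P: "(x ^^ i) (w r) \<in> part M (r + of_nat i)" for r using w(1) pow_part by blast
    have "(x ^^ i) (w q) = (x ^^ i) u \<ominus> (x ^^ i) (w p)"
      using cl unfolding wp by (simp add: a_minus_def M.a_assoc M.r_neg)
    then have "(x ^^ i) (w q) \<in> part M (p + of_nat i)" using partD(6)[OF v(2) P] u(2) by simp
    moreover have "(x ^^ i) (w q) \<in> part M (p + of_nat i + 1)"
      using P[of q] unfolding q_def by (simp only: add_ac)
    ultimately have "(x ^^ i) (w q) = \<zero>" by (rule part_disjoint)
    then have "(x ^^ i) (w p) = v" using u(2) cl unfolding wp by simp
    then show ?thesis using w(1) by blast
  qed
  have part: "?f ` part ?G p = part (parity_shift i ?H) p" for p
  proof -
    have "?f ` part ?G p = part ?H (p + of_nat i)"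
    proof (intro equalityI subsetI)
      fix A assume "A \<in> ?f ` part ?G p"
      then obtain v where "v \<in> weight (int i)" "v \<in> part M p" "A = weight (- int i - 1) +> (x ^^ i) v"
        by (auto simp: weight.Gr_simps)
      then show "A \<in> part ?H (p + of_nat i)" using sh(2) pow_part unfolding weight.Gr_simps by blast
    next
      fix A assume "A \<in> part ?H (p + of_nat i)"
      then obtain v where "v \<in> weight (- int i)" "v \<in> part M (p + of_nat i)" "A = weight (- int i - 1) +> v"
        unfolding weight.Gr_simps by blast
      then obtain u where "u \<in> weight (int i) \<inter> part M p" "A = weight (- int i - 1) +> (x ^^ i) u"
        using surj by blast
      then show "A \<in> ?f ` part ?G p"
        by (intro image_eqI[of _ _ "weight (int i - 1) +> u"]) (auto simp: weight.Gr_simps)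
    qed
    then show ?thesis by (simp add: parity_shift_def)
  qed
  have "bij_betw ?f (carrier ?G) (carrier ?H)"
  proof (rule bij_betw_imageI)
    show "inj_on ?f (carrier ?G)"
    proof (rule inj_onI)
      fix A B assume "A \<in> carrier ?G" "B \<in> carrier ?G" and eq: "?f A = ?f B"
      then obtain u v where uv: "u \<in> weight (int i)" "v \<in> weight (int i)"
        "A = weight (int i - 1) +> u" "B = weight (int i - 1) +> v"
        by (auto simp: weight.Gr_simps)
      note cl = uv(1,2)[THEN weight_closed]
      have "(x ^^ i) (u \<ominus> v) \<in> weight (- int i - 1)"
        using eq uv cl coset_eq_iff[OF weight_subsuperspace] by simp
      then have "u \<ominus> v \<in> weight (int i - 1)" using weight_inj weight.FD(6)[OF uv(1,2)] by blast
      then show "A = B" using uv cl coset_eq_iff[OF weight_subsuperspace] by simp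
    qed
    show "?f ` carrier ?G = carrier ?H"
    proof (intro equalityI subsetI)
      fix A assume "A \<in> carrier ?H"
      then obtain v where v: "v \<in> weight (- int i)" "A = weight (- int i - 1) +> v"
        by (auto simp: weight.Gr_simps)
      then obtain u where "u \<in> weight (int i)" "(x ^^ i) u = v" using weight_surj by blast
      then show "A \<in> ?f ` carrier ?G" using v by (force simp: weight.Gr_simps)
    qed (use linear_mapsD(1)[OF lin] in auto)
  qed
  then show "superspace_iso ?G (parity_shift i ?H) ?f"
    using lin part by (auto simp: superspace_iso_def parity_shift_def linear_maps_def hom_def)
qed (rule weight_subsuperspace weight_step)+

text \<open>The conditions on graded pieces are first lifted to \<open>F\<close> itself:
  \<open>x^k\<close> maps \<open>F k\<close> onto \<open>F (- k)\<close>, and the kernel of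
  \<open>x^k\<close> lies in \<open>F (k - 1)\<close>. These yield \<open>weight k\<close> inside
  \<open>F k\<close>. The converse is shown by downward induction for \<open>k >= 0\<close> and
  carried to negative degrees by applying powers of \<open>x\<close>.\<close>

lemma deligne_unique:
  assumes "is_deligne_filtration M x F"
  shows "F = weight"
proof -
  from assms have subF: "\<And>i. subsuperspace (F i) M" "\<And>i. F i \<subseteq> F (i + 1)"
    and bot: "\<exists>i. F i = {\<zero>}" and top: "\<exists>i. F i = carrier M" and sh: "\<And>i. x ` F i \<subseteq> F (i - 2)"
    and iso: "\<And>i::nat. superspace_iso (Gr M F (int i)) (parity_shift i (Gr M F (- int i)))
       (Gr_map M F (x ^^ i) (- int i))"
    unfolding is_deligne_filtration_def by auto
  interpret F: super_filtration M F by unfold_locales (rule subF)+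
  note shp = funpow_image[of F, OF sh]
  have map: "Gr_map M F (x ^^ k) (- int k) (F (int k - 1) +> v) = F (- int k - 1) +> (x ^^ k) v"
    if "v \<in> carrier M" for v k
  proof (rule F.Gr_map_coset[OF pow_linear _ that])
    have "int k - 1 - 2 * int k = - int k - 1" by simp
    then show "(x ^^ k) ` F (int k - 1) \<subseteq> F (- int k - 1)" using shp[of _ "int k - 1" k] by auto
  qed
  have bij: "bij_betw (Gr_map M F (x ^^ k) (- int k)) (carrier (Gr M F (int k))) (carrier (Gr M F (- int k)))" for k
    using iso[of k] by (simp add: superspace_iso_def parity_shift_def)
  have inj: "u \<in> F (int k - 1)" if u: "u \<in> F (int k)" "(x ^^ k) u \<in> F (- int k - 1)" for u k
  proof -
    have "F (- int k - 1) +> (x ^^ k) u = F (- int k - 1) +> (x ^^ k) \<zero>"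
      using u F.FD(1) coset_eq_iff[OF subF(1)] by simp
    then have "F (int k - 1) +> u = F (int k - 1) +> \<zero>"
      using map[of u k] map[of \<zero> k] bij[of k] u F.FD(1,2)
      by (auto simp: bij_betw_def inj_on_def F.Gr_simps)
    then show ?thesis using coset_eq_iff[OF subF(1)] F.FD(1)[OF u(1)] by simp
  qed
  have surj': "\<exists>u\<in>F (int k). v \<ominus> (x ^^ k) u \<in> F (- int k - 1)" if v: "v \<in> F (- int k)" for v k
  proof -
    have "F (- int k - 1) +> v \<in> Gr_map M F (x ^^ k) (- int k) ` carrier (Gr M F (int k))"
      using v bij[of k] by (simp add: bij_betw_def F.Gr_simps)
    then obtain u where "u \<in> F (int k)" "F (- int k - 1) +> v = F (- int k - 1) +> (x ^^ k) u"
      using map F.FD(1) by (auto simp: F.Gr_simps)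
    then show ?thesis using coset_eq_iff[OF subF(1)] F.FD(1) v by (metis pow(1))
  qed
  obtain b where b: "F b = {\<zero>}" using bot by blast
  \<comment> \<open>Modulo \<open>F (- k - 1)\<close> a preimage \<open>u\<close> exists. By
    induction towards the degree \<open>b\<close> where \<open>F\<close> vanishes, the error equals
    \<open>x^(k+1) w\<close> with \<open>w\<close> in \<open>F (k + 1)\<close>, and
    \<open>u + x w\<close> is an exact preimage.\<close>
  have surj: "\<exists>u\<in>F (int k). (x ^^ k) u = v" if "v \<in> F (- int k)" for v k
    using that
  proof (induction "nat (- int k - b)" arbitrary: k v rule: less_induct)
    case less
    show ?case
    proof (cases "- int k \<le> b")
      case True
      then have "v = \<zero>" using F.mono b less.prems by blast
      then show ?thesis using F.FD(2)[of "int k"] by (auto intro!: bexI[of _ \<zero>])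
    next
      case False
      have "- int (Suc k) = - int k - 1" by simp
      then obtain u where u: "u \<in> F (int k)" "v \<ominus> (x ^^ k) u \<in> F (- int (Suc k))"
        using surj'[OF less.prems] by metis
      obtain w where w: "w \<in> F (int (Suc k))" "(x ^^ Suc k) w = v \<ominus> (x ^^ k) u"
        using less.hyps[OF _ u(2)] False by auto
      have "x w \<in> F (int (Suc k) - 2)" using sh w(1) by blast
      then have xw: "x w \<in> F (int k)" using F.mono[of "int (Suc k) - 2" "int k"] by auto
      have cl: "u \<in> carrier M" "v \<in> carrier M" "x w \<in> carrier M" using u(1) xw less.prems F.FD(1) by auto
      have "(x ^^ k) (u \<oplus> x w) = v"
        using w(2) cl add_left_commute_cancel[of v "(x ^^ k) u"] by (simp add: funpow_swap1)
      then show ?thesis using F.FD(3)[OF u(1) xw] by blast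
    qed
  qed
  obtain t where t: "F t = carrier M" using top by blast
  \<comment> \<open>Starting from the degree \<open>t\<close> where \<open>F\<close> is everything,
    \<open>v\<close> descends one step at a time: in \<open>F (k + m)\<close> it is killed by
    \<open>x^(k+m)\<close>, so injectivity on that graded piece puts it in
    \<open>F (k + m - 1)\<close>, down to \<open>F (k - 1)\<close>.\<close>
  have ker: "v \<in> F (int k - 1)" if v: "v \<in> carrier M" "(x ^^ k) v = \<zero>" for v k
  proof -
    have "v \<in> F (int k - 1 + int m) \<Longrightarrow> v \<in> F (int k - 1)" for m
    proof (induction m)
      case (Suc m)
      have "(x ^^ (m + k)) v = \<zero>" using v pow_add[of m k v] by simp
      then have "v \<in> F (int (m + k) - 1)"
        using Suc.prems F.FD(2) by (intro inj) (simp_all add: algebra_simps)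
      then show ?case using Suc.IH by (simp add: algebra_simps)
    qed simp
    moreover have "v \<in> F (int k - 1 + int (nat (t - int k + 1)))"
      using F.mono[of t "int k - 1 + int (nat (t - int k + 1))"] t v by auto
    ultimately show ?thesis by blast
  qed
  have le: "weight k \<subseteq> F k" for k
  proof
    show "v \<in> F k" if "v \<in> weight k" for v using that
    proof (induction rule: weight.induct)
      case (gen z i j)
      have "z \<in> F (int (i + j))" using ker[OF gen(1,2)] by simp
      from shp[OF this, of j] gen(3) show ?case by (simp add: algebra_simps)
    qed (rule F.FD)
  qed
  \<comment> \<open>Degrees \<open>k + 1\<close> and \<open>k + 2\<close> are known by induction.
    For \<open>u\<close> in \<open>F k\<close> the vector \<open>x^(k+1) u\<close> lies in
    \<open>F (- k - 2)\<close>, so it is \<open>x^(k+2) w\<close> with \<open>w\<close> in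
    \<open>F (k + 2)\<close> and hence lies in \<open>weight (- k - 2)\<close>. As \<open>u\<close>
    is in \<open>weight (k + 1)\<close>, injectivity of \<open>x^(k+1)\<close> on that graded piece
    puts it in \<open>weight k\<close>.\<close>
  have ge: "F (int k) \<subseteq> weight (int k)" for k
  proof (induction "n - k" arbitrary: k rule: less_induct)
    case less
    show ?case
    proof (cases "n \<le> k")
      case True
      then show ?thesis using weight_top[of "int k"] F.FD(1) by auto
    next
      case False
      show ?thesis
      proof
        fix u assume u: "u \<in> F (int k)"
        have S: "F (int (Suc k)) \<subseteq> weight (int (Suc k))" "F (int (Suc (Suc k))) \<subseteq> weight (int (Suc (Suc k)))"
          by (rule less; use False in simp)+
        have uw: "u \<in> weight (int (Suc k))" using S(1) subF(2)[of "int k"] u by (auto simp: algebra_simps)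
        have "(x ^^ Suc k) u \<in> F (- int (Suc (Suc k)))"
          using shp[OF u, of "Suc k"] by (simp add: algebra_simps)
        then obtain w where w: "w \<in> F (int (Suc (Suc k)))" "(x ^^ Suc (Suc k)) w = (x ^^ Suc k) u" using surj by blast
        then have "(x ^^ Suc k) u \<in> weight (- int (Suc k) - 1)"
          using weight_shift_pow[of w "int (Suc (Suc k))" "Suc (Suc k)"] S(2) by (auto simp: algebra_simps)
        from weight_inj[OF uw this] show "u \<in> weight (int k)" by simp
      qed
    qed
  qed
  have "F k \<subseteq> weight k" for k
  proof (cases "k \<ge> 0")
    case True
    then show ?thesis using ge[of "nat k"] by simp
  next
    case False
    then obtain m where m: "k = - int m" using that[of "nat (- k)"] by simp
    show ?thesis
    proof
      fix v assume "v \<in> F k"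
      then obtain u where "u \<in> F (int m)" "(x ^^ m) u = v" using surj m by blast
      then show "v \<in> weight k" using ge[of m] weight_shift_pow[of u "int m" m] m by auto
    qed
  qed
  with le show ?thesis by (intro ext equalityI)
qed

lemma deligne_filtration_eq: "deligne_filtration M x = weight"
  unfolding deligne_filtration_def
  by (rule the_equality[of "is_deligne_filtration M x", OF weight_deligne deligne_unique])

end

section \<open>Graded spaces of Lefschetz type\<close>

text \<open>The operator \<open>X\<close> is called \<open>f\<close> (and \<open>Y\<close> later \<open>g\<close>), because \<open>X\<close> is notation of HOL-Algebra for
  the indeterminate of a polynomial ring.\<close>

locale graded_lefschetz = odd_superspace V f
  for V :: "('k::field, 'v) superspace" (structure) and f :: "'v \<Rightarrow> 'v" +
  fixes D :: "int \<Rightarrow> 'v set" and N :: nat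
  assumes sub: "subsuperspace (D i) V"
    and shift: "f ` D i \<subseteq> D (i - 1)"
    and lefschetz: "bij_betw (f ^^ (2 * n)) (D (int n)) (D (- int n))"
    and bounded: "N \<le> n \<Longrightarrow> D (int n) = {\<zero>}"
begin

lemmas DD = submoduleD[OF subsuperspaceD(1)[OF sub]]

lemma shift': "v \<in> D i \<Longrightarrow> f v \<in> D (i - 1)"
  using shift by blast

lemma shift_pow: "v \<in> D i \<Longrightarrow> (f ^^ k) v \<in> D (i - int k)"
proof (induction k)
  case (Suc k)
  then have "f ((f ^^ k) v) \<in> D (i - int k - 1)" by (intro shift')
  then show ?case by (simp add: algebra_simps)
qed simp

section \<open>Lefschetz isomorphisms and primitive decomposition\<close>

lemma lefschetz_inj:
  "u \<in> D (int n) \<Longrightarrow> v \<in> D (int n) \<Longrightarrow> (f ^^ (2 * n)) u = (f ^^ (2 * n)) v \<Longrightarrow> u = v"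
  using lefschetz[of n] by (auto simp: bij_betw_def inj_on_def)

lemma lefschetz_surj:
  assumes "v \<in> D (- int n)"
  obtains u where "u \<in> D (int n)" "(f ^^ (2 * n)) u = v"
proof -
  have "v \<in> (f ^^ (2 * n)) ` D (int n)" using lefschetz[of n] assms by (simp add: bij_betw_def)
  then show thesis using that by blast
qed

text \<open>An even power of an odd operator preserves parity, so the component of \<open>v\<close>
  of the wrong parity is sent to zero, and it vanishes by injectivity on \<open>D n\<close>.\<close>

lemma parity_lefschetz:
  assumes "v \<in> D (int n)" "(f ^^ (2 * n)) v \<in> part V p"
  shows "v \<in> part V p"
proof -
  obtain w where w: "\<And>p. w p \<in> part V p" "v = w 0 \<oplus> w 1"
    using parity_decomposition DD(1)[OF assms(1)] by blast
  then have D: "w r \<in> D (int n)" for r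
    using subsuperspaceD(2)[OF sub w(1) w(1)] assms(1) by (cases r) auto
  note cl = DD(1)[OF D]
  define q where "q = p + 1"
  have v: "v = w q \<oplus> w p" using w(2) cl M.a_comm unfolding q_def by (cases p) auto
  have P: "(f ^^ (2 * n)) (w r) \<in> part V r" for r
  proof -
    have "r + of_nat (2 * n) = r" by simp
    then show ?thesis using pow_part[OF w(1), of "2 * n" r] by metis
  qed
  have "(f ^^ (2 * n)) (w q) = (f ^^ (2 * n)) v \<ominus> (f ^^ (2 * n)) (w p)"
    using cl unfolding v by (simp add: a_minus_def M.a_assoc M.r_neg)
  then have "(f ^^ (2 * n)) (w q) \<in> part V p" using partD(6)[OF assms(2) P] by simp
  then have "(f ^^ (2 * n)) (w q) = \<zero>" using part_disjoint P[of q] unfolding q_def by blast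
  then have "w q = \<zero>" using lefschetz_inj[OF D DD(2)] by simp
  then show ?thesis using v cl w(1) by simp
qed

text \<open>This encodes the primitive decomposition of degree \<open>n >= 0\<close>: as
  \<open>f^(2n+2) (T n v) = f^(2n+1) v\<close>, the vector \<open>v - f (T n v)\<close> is killed by
  \<open>f^(2n+1)\<close>.\<close>

definition T :: "nat \<Rightarrow> 'v \<Rightarrow> 'v"
  where "T n v = the_inv_into (D (int (Suc n))) (f ^^ (2 * Suc n)) ((f ^^ Suc (2 * n)) v)"

lemma T:
  assumes "v \<in> D (int n)"
  shows "T n v \<in> D (int (Suc n))" "(f ^^ (2 * Suc n)) (T n v) = (f ^^ Suc (2 * n)) v"
proof -
  have "int n - int (Suc (2 * n)) = - int (Suc n)" by simp
  then have "(f ^^ Suc (2 * n)) v \<in> D (- int (Suc n))"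
    using shift_pow[OF assms, of "Suc (2 * n)"] by metis
  then have *: "(f ^^ Suc (2 * n)) v \<in> (f ^^ (2 * Suc n)) ` D (int (Suc n))"
    using lefschetz[of "Suc n"] unfolding bij_betw_def by blast
  have inj: "inj_on (f ^^ (2 * Suc n)) (D (int (Suc n)))"
    using lefschetz[of "Suc n"] unfolding bij_betw_def by blast
  show "T n v \<in> D (int (Suc n))" unfolding T_def by (rule the_inv_into_into[OF inj * subset_refl])
  show "(f ^^ (2 * Suc n)) (T n v) = (f ^^ Suc (2 * n)) v"
    unfolding T_def by (rule f_the_inv_into_f[OF inj *])
qed

lemma T_unique:
  "v \<in> D (int n) \<Longrightarrow> w \<in> D (int (Suc n)) \<Longrightarrow> (f ^^ (2 * Suc n)) w = (f ^^ Suc (2 * n)) v \<Longrightarrow> T n v = w"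
  by (rule lefschetz_inj[OF T(1)]) (simp_all only: T(2))

text \<open>An odd linear map of degree one, required on a single degree only, because
  \<open>Y\<close> is built degree by degree and glued together at the end.\<close>

definition raising :: "int \<Rightarrow> ('v \<Rightarrow> 'v) \<Rightarrow> bool"
  where "raising i g \<longleftrightarrow> (\<forall>v\<in>D i. g v \<in> D (i + 1)) \<and> (\<forall>u\<in>D i. \<forall>v\<in>D i. g (u \<oplus> v) = g u \<oplus> g v) \<and>
    (\<forall>c. \<forall>v\<in>D i. g (c \<odot> v) = c \<odot> g v) \<and> (\<forall>p. \<forall>v\<in>D i \<inter> part V p. g v \<in> part V (p + 1))"

lemma raisingD:
  assumes "raising i g" "v \<in> D i"
  shows "g v \<in> D (i + 1)" "u \<in> D i \<Longrightarrow> g (v \<oplus> u) = g v \<oplus> g u" "g (c \<odot> v) = c \<odot> g v"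
    "v \<in> part V p \<Longrightarrow> g v \<in> part V (p + 1)"
  using assms unfolding raising_def by blast+

lemma raising_zero: "raising i g \<Longrightarrow> g \<zero> = \<zero>"
  using raisingD(3)[of i g \<zero> 0] raisingD(1)[of i g \<zero>] DD(1,2) by simp

text \<open>Linearity comes from uniqueness of the preimage under \<open>f^(2n+2)\<close>. Oddness
  holds because \<open>T\<close> applies \<open>f\<close> an odd number of times and then inverts an
  even power.\<close>

lemma raising_T: "raising (int n) (T n)"
  unfolding raising_def
proof (intro conjI ballI allI)
  fix v assume v: "v \<in> D (int n)"
  show "T n v \<in> D (int n + 1)" using T(1)[OF v] by (simp add: add_ac)
  show "T n (u \<oplus> v) = T n u \<oplus> T n v" if u: "u \<in> D (int n)" for u
  proof (rule T_unique)
    show "(f ^^ (2 * Suc n)) (T n u \<oplus> T n v) = (f ^^ Suc (2 * n)) (u \<oplus> v)"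
      by (simp only: pow T(2) DD(1)[OF T(1)] DD(1)[OF u] DD(1)[OF v] u v)
  qed (auto simp del: of_nat_Suc intro: DD T u v)
  show "T n (c \<odot> v) = c \<odot> T n v" for c
  proof (rule T_unique)
    show "(f ^^ (2 * Suc n)) (c \<odot> T n v) = (f ^^ Suc (2 * n)) (c \<odot> v)"
      by (simp only: pow T(2) DD(1)[OF T(1)] DD(1)[OF v] v)
  qed (auto simp del: of_nat_Suc intro: DD T v)
next
  fix v p assume v: "v \<in> D (int n) \<inter> part V p"
  have "(f ^^ Suc (2 * n)) v \<in> part V (p + of_nat (Suc (2 * n)))" by (rule pow_part) (use v in blast)
  moreover have "p + of_nat (Suc (2 * n)) = p + 1" by simp
  ultimately have "(f ^^ (2 * Suc n)) (T n v) \<in> part V (p + 1)" using T(2) v by (metis IntD1)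
  then show "T n v \<in> part V (p + 1)" using parity_lefschetz T(1) v by blast
qed

text \<open>The first argument counts the remaining steps of the upward recursion
  \<open>Y v = (2n+2) T v - f (Y (T v))\<close>. After \<open>N - n\<close> steps from degree
  \<open>n\<close> the degree is \<open>N\<close>, where the space is zero and the default value
  \<open>0\<close> is correct.\<close>

primrec Y_iter :: "nat \<Rightarrow> nat \<Rightarrow> 'v \<Rightarrow> 'v"
  where
    "Y_iter 0 n v = \<zero>"
  | "Y_iter (Suc m) n v = of_nat (2 * Suc n) \<odot> T n v \<ominus> f (Y_iter m (Suc n) (T n v))"

lemmas f = linear_mapsD[OF x_linear]

lemma f_part: "v \<in> part V p \<Longrightarrow> f v \<in> part V (p + 1)"
  using pow_part[of v p 1] by simp

lemma raising_Y_iter: "raising (int n) (Y_iter m n)"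
proof (induction m arbitrary: n)
  case 0
  show ?case by (auto simp: raising_def DD partD)
next
  case (Suc m)
  note Y = raisingD[OF Suc.IH[of "Suc n"]] and T' = raisingD[OF raising_T[of n]] and T = T(1)[of _ n]
  have D: "f (Y_iter m (Suc n) (T n v)) \<in> D (int n + 1)" if "v \<in> D (int n)" for v
    using shift'[OF Y(1)[OF T[OF that]]] by (simp add: add_ac)
  note cl = DD(1)[OF T] DD(1)[OF Y(1)[OF T]] DD(1)[OF D]
  show ?case unfolding raising_def
  proof (intro conjI ballI allI)
    fix v assume v: "v \<in> D (int n)"
    show "Y_iter (Suc m) n v \<in> D (int n + 1)" using D v T'(1) by (auto intro!: DD)
    show "Y_iter (Suc m) n (u \<oplus> v) = Y_iter (Suc m) n u \<oplus> Y_iter (Suc m) n v" if "u \<in> D (int n)" for u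
      using that v T by (simp add: T' Y f cl scale_add_right minus_add_minus del: of_nat_Suc of_nat_add of_nat_mult)
    show "Y_iter (Suc m) n (c \<odot> v) = c \<odot> Y_iter (Suc m) n v" for c
      using v T by (simp add: T' Y f cl scale_scale scale_diff mult.commute del: of_nat_Suc of_nat_add of_nat_mult)
  next
    fix v p assume v: "v \<in> D (int n) \<inter> part V p"
    \<comment> \<open>Three odd maps are composed, and two of the three parity shifts
      cancel.\<close>
    then have "f (Y_iter m (Suc n) (T n v)) \<in> part V (p + 1 + 1 + 1)" using T by (blast intro: f_part Y T')
    then have "f (Y_iter m (Suc n) (T n v)) \<in> part V (p + 1)" by (simp only: bit_add_self)
    then show "Y_iter (Suc m) n v \<in> part V (p + 1)"
      using v T'(4) by (auto simp del: add_bit_eq_xor intro!: partD)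
  qed
qed

section \<open>The operator Y in nonnegative and nonpositive degrees\<close>

definition Y_nonneg :: "nat \<Rightarrow> 'v \<Rightarrow> 'v"
  where "Y_nonneg n = Y_iter (N - n) n"

lemma raising_Y_nonneg: "raising (int n) (Y_nonneg n)"
  unfolding Y_nonneg_def by (rule raising_Y_iter)

text \<open>Below \<open>N\<close> the number of remaining steps drops by one as the degree rises by
  one. From \<open>N\<close> on the space is zero and both sides vanish.\<close>

lemma Y_nonneg_rec:
  assumes "v \<in> D (int n)"
  shows "Y_nonneg n v = of_nat (2 * Suc n) \<odot> T n v \<ominus> f (Y_nonneg (Suc n) (T n v))"
proof (cases "n < N")
  case True
  then have "N - n = Suc (N - Suc n)" by simp
  then show ?thesis by (simp add: Y_nonneg_def)
next
  case False
  then have "v = \<zero>" using bounded[of n] assms by simp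
  then show ?thesis
    using raising_zero[OF raising_Y_nonneg[of n]] raising_zero[OF raising_Y_nonneg[of "Suc n"]]
      raising_zero[OF raising_T[of n]] pow_zero[of 1] by simp
qed

text \<open>The formula is forced: \<open>Y f + f Y = h\<close> and \<open>h f - f h = - 2 f\<close>
  give \<open>Y f^2 = f^2 Y - 2 f\<close>, and \<open>n\<close> applications move \<open>Y\<close>
  past \<open>f^(2n)\<close>. For \<open>n = 0\<close> the exponent \<open>2 * n - 1\<close> is
  truncated to \<open>0\<close>, but its coefficient is \<open>0\<close> as well.\<close>

definition Y_nonpos :: "nat \<Rightarrow> 'v \<Rightarrow> 'v"
  where "Y_nonpos n v = (let w = the_inv_into (D (int n)) (f ^^ (2 * n)) v in
    (f ^^ (2 * n)) (Y_nonneg n w) \<ominus> of_nat (2 * n) \<odot> (f ^^ (2 * n - 1)) w)"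

lemma Y_nonpos:
  assumes "w \<in> D (int n)"
  shows "Y_nonpos n ((f ^^ (2 * n)) w) =
    (f ^^ (2 * n)) (Y_nonneg n w) \<ominus> of_nat (2 * n) \<odot> (f ^^ (2 * n - 1)) w"
  using the_inv_into_f_f[of "f ^^ (2 * n)" "D (int n)" w] lefschetz[of n] assms
  by (simp add: Y_nonpos_def bij_betw_def)

lemma raising_Y_nonpos: "raising (- int n) (Y_nonpos n)"
proof -
  note Y = raisingD[OF raising_Y_nonneg[of n]]
  note cl = DD(1) DD(1)[OF Y(1)]
  have s: "\<exists>w\<in>D (int n). v = (f ^^ (2 * n)) w" if "v \<in> D (- int n)" for v
    using lefschetz_surj[OF that] by metis
  show ?thesis unfolding raising_def
  proof (intro conjI ballI allI)
    fix v assume "v \<in> D (- int n)"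
    then obtain w where w: "w \<in> D (int n)" "v = (f ^^ (2 * n)) w" using s by blast
    have "int n + 1 - int (2 * n) = - int n + 1" by simp
    then have 1: "(f ^^ (2 * n)) (Y_nonneg n w) \<in> D (- int n + 1)"
      using shift_pow[OF Y(1)[OF w(1)], of "2 * n"] by metis
    have 2: "of_nat (2 * n) \<odot> (f ^^ (2 * n - 1)) w \<in> D (- int n + 1)"
    proof (cases n)
      case 0
      then show ?thesis using w DD(1,2) by simp
    next
      case (Suc m)
      then have "int n - int (2 * n - 1) = - int n + 1" by simp
      then show ?thesis using shift_pow[OF w(1), of "2 * n - 1"] DD(4) by metis
    qed
    show "Y_nonpos n v \<in> D (- int n + 1)"
      unfolding w(2) Y_nonpos[OF w(1)] by (rule DD(6)[OF 1 2])
    show "Y_nonpos n (c \<odot> v) = c \<odot> Y_nonpos n v" for c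
    proof -
      have e: "c \<odot> v = (f ^^ (2 * n)) (c \<odot> w)" using w cl by simp
      show ?thesis unfolding e Y_nonpos[OF DD(4)[OF w(1)]] unfolding w(2) Y_nonpos[OF w(1)]
        using w(1) by (simp add: Y cl scale_diff scale_scale mult.commute del: of_nat_mult)
    qed
    show "Y_nonpos n (u \<oplus> v) = Y_nonpos n u \<oplus> Y_nonpos n v" if "u \<in> D (- int n)" for u
    proof -
      obtain z where z: "z \<in> D (int n)" "u = (f ^^ (2 * n)) z" using s \<open>u \<in> D (- int n)\<close> by blast
      have e: "u \<oplus> v = (f ^^ (2 * n)) (z \<oplus> w)" using w z cl by simp
      show ?thesis unfolding e Y_nonpos[OF DD(3)[OF z(1) w(1)]]
        unfolding w(2) z(2) Y_nonpos[OF w(1)] Y_nonpos[OF z(1)]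
        using w(1) z(1) by (simp add: Y cl scale_add_right minus_add_minus del: of_nat_mult)
    qed
  next
    fix v p assume v: "v \<in> D (- int n) \<inter> part V p"
    then obtain w where w: "w \<in> D (int n)" "v = (f ^^ (2 * n)) w" using s by blast
    have wp: "w \<in> part V p" using parity_lefschetz[OF w(1)] w(2) v by blast
    have "(f ^^ (2 * n)) (Y_nonneg n w) \<in> part V (p + 1 + of_nat (2 * n))" by (intro pow_part Y w wp)
    then have 1: "(f ^^ (2 * n)) (Y_nonneg n w) \<in> part V (p + 1)" by (simp del: add_bit_eq_xor)
    have 2: "of_nat (2 * n) \<odot> (f ^^ (2 * n - 1)) w \<in> part V (p + 1)"
    proof (cases n)
      case 0
      then show ?thesis using w DD(1) partD(2) by simp
    next
      case (Suc m)
      then have "2 * n - 1 = Suc (2 * m)" by simp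
      moreover have "p + of_nat (Suc (2 * m)) = p + 1" by simp
      ultimately have "(f ^^ (2 * n - 1)) w \<in> part V (p + 1)" using pow_part[OF wp, of "2 * n - 1"] by metis
      then show ?thesis by (rule partD)
    qed
    show "Y_nonpos n v \<in> part V (p + 1)"
      unfolding w(2) Y_nonpos[OF w(1)] by (rule partD(6)[OF 1 2])
  qed
qed

section \<open>The operator Y in all degrees and its anticommutator with X\<close>

definition Y :: "int \<Rightarrow> 'v \<Rightarrow> 'v"
  where "Y i = (if i < 0 then Y_nonpos (nat (- i)) else Y_nonneg (nat i))"

lemma raising_Y: "raising i (Y i)"
  using raising_Y_nonneg[of "nat i"] raising_Y_nonpos[of "nat (- i)"] by (auto simp: Y_def)

text \<open>Degree zero belongs to the branch \<open>Y_nonneg\<close>. There \<open>f^0\<close> is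
  the identity and the correction term has coefficient \<open>0\<close>, so both descriptions
  agree.\<close>

lemma Y_nonpos_eq: "w \<in> D (int n) \<Longrightarrow> Y (- int n) ((f ^^ (2 * n)) w) =
    (f ^^ (2 * n)) (Y_nonneg n w) \<ominus> of_nat (2 * n) \<odot> (f ^^ (2 * n - 1)) w"
  using Y_nonpos[of w n] raisingD(1)[OF raising_Y_nonneg[of n], of w] DD(1)
  by (cases "n = 0") (auto simp: Y_def)

text \<open>For \<open>i > 0\<close> put \<open>n = i - 1\<close>: then
  \<open>T n (f v) = v\<close>, and the claim is the recursion for \<open>Y\<close> at
  \<open>f v\<close>. For \<open>i = - n <= 0\<close> write \<open>v = f^(2n) w\<close> and
  \<open>z = T n w\<close>, so that \<open>f v = f^(2n+2) z\<close> and both terms are given by the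
  formula for nonpositive degrees.\<close>

lemma Y_anticommutator:
  assumes v: "v \<in> D i"
  shows "Y (i - 1) (f v) \<oplus> f (Y i v) = of_int (2 * i) \<odot> v"
proof (cases "i > 0")
  case True
  then obtain n where n: "i = int (Suc n)" by (metis Suc_pred' zero_less_imp_eq_int of_nat_0_less_iff)
  have Xv: "f v \<in> D (int n)" using shift'[OF v] n by simp
  have T: "T n (f v) = v"
    by (rule T_unique[OF Xv]) (use v n in \<open>simp_all add: funpow_swap1\<close>)
  have cl: "v \<in> carrier V" "f (Y_nonneg (Suc n) v) \<in> carrier V"
    using v n f(1)[OF DD(1)[OF raisingD(1)[OF raising_Y_nonneg[of "Suc n"]]]] DD(1) by auto
  have "Y (i - 1) (f v) = of_nat (2 * Suc n) \<odot> v \<ominus> f (Y i v)"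
    using Y_nonneg_rec[OF Xv] unfolding T by (simp add: n Y_def nat_add_distrib)
  moreover have "Y i v = Y_nonneg (Suc n) v" by (simp add: n Y_def nat_add_distrib)
  ultimately show ?thesis using cl by (simp add: n a_minus_def M.a_assoc M.l_neg)
next
  case False
  then obtain n where n: "i = - int n" using that[of "nat (- i)"] by simp
  obtain w where w: "w \<in> D (int n)" "(f ^^ (2 * n)) w = v" using lefschetz_surj v n by blast
  define z where "z = T n w"
  have z: "z \<in> D (int (Suc n))" "(f ^^ (2 * Suc n)) z = (f ^^ Suc (2 * n)) w"
    using T[OF w(1)] by (simp_all only: z_def)
  define y where "y = Y_nonneg (Suc n) z"
  have y: "y \<in> carrier V" unfolding y_def using raisingD(1)[OF raising_Y_nonneg z(1)] DD(1) by blast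
  note cl = DD(1)[OF w(1)] DD(1)[OF z(1)] DD(1)[OF v] y
  \<comment> \<open>The formula gives \<open>Y (f v) = a - b\<close>, while the recursion for
    \<open>Y w\<close> gives \<open>f (Y v) = (b - a) - 2n v\<close>. The sum is
    \<open>- 2n v = 2i v\<close>.\<close>
  define a where "a = (f ^^ Suc (2 * n)) (f y)"
  define b where "b = of_nat (2 * Suc n) \<odot> (f ^^ Suc (2 * n)) z"
  have acl: "a \<in> carrier V" "b \<in> carrier V" unfolding a_def b_def
    by (rule pow(1) scale_closed f(1) cl)+
  have fv: "f v = (f ^^ (2 * Suc n)) z" using z(2) w(2) by simp
  have i: "i - 1 = - int (Suc n)" using n by simp
  have "Y (i - 1) (f v) = (f ^^ (2 * Suc n)) y \<ominus> b"
    unfolding fv i Y_nonpos_eq[OF z(1)] y_def b_def by simp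
  then have 1: "Y (i - 1) (f v) = a \<ominus> b"
    by (simp add: a_def funpow_swap1)
  have c: "f (of_nat (2 * n) \<odot> (f ^^ (2 * n - 1)) w) = of_nat (2 * n) \<odot> v"
  proof (cases n)
    case 0
    then show ?thesis using w cl pow_zero[of 1] by simp
  next
    case (Suc m)
    then have "f ((f ^^ (2 * n - 1)) w) = v" using w(2) by simp
    then show ?thesis using cl by (simp add: f)
  qed
  have "f ((f ^^ (2 * n)) (Y_nonneg n w)) = (f ^^ Suc (2 * n)) (of_nat (2 * Suc n) \<odot> z \<ominus> f y)"
    using Y_nonneg_rec[OF w(1)] by (simp add: z_def y_def)
  also have "\<dots> = b \<ominus> a" unfolding a_def b_def using cl f(1)
    by (simp only: pow_minus pow scale_closed)
  finally have fY: "f ((f ^^ (2 * n)) (Y_nonneg n w)) = b \<ominus> a" .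
  have A: "(f ^^ (2 * n)) (Y_nonneg n w) \<in> carrier V"
    by (rule pow(1)[OF DD(1)[OF raisingD(1)[OF raising_Y_nonneg w(1)]]])
  have B: "of_nat (2 * n) \<odot> (f ^^ (2 * n - 1)) w \<in> carrier V"
    by (rule scale_closed[OF pow(1)[OF cl(1)]])
  have "Y i v = (f ^^ (2 * n)) (Y_nonneg n w) \<ominus> of_nat (2 * n) \<odot> (f ^^ (2 * n - 1)) w"
    using Y_nonpos_eq[OF w(1)] by (simp only: n w(2))
  then have "f (Y i v) = (b \<ominus> a) \<ominus> of_nat (2 * n) \<odot> v"
    by (simp only: linear_maps_minus[OF superspace_axioms superspace_axioms x_linear A B] fY c)
  moreover have "of_int (2 * i) \<odot> v = \<ominus> (of_nat (2 * n) \<odot> v)"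
    using cl(3) by (simp add: n scale_minus_left)
  moreover have "(a \<ominus> b) \<oplus> ((b \<ominus> a) \<ominus> d) = \<ominus> d" if "d \<in> carrier V" for d
    using acl that by (simp add: a_minus_def M.a_assoc M.r_neg1 M.r_neg2)
  ultimately show ?thesis by (simp only: 1 scale_closed[OF cl(3)])
qed

text \<open>For \<open>v\<close> in \<open>D n\<close> with \<open>n >= 0\<close>, descend from
  \<open>N\<close> and write \<open>v = f z + u\<close> with \<open>z = T n v\<close>. By induction
  \<open>E z = 0\<close>, hence \<open>E (f z) = 0\<close>. As \<open>f^(2n+1) u = 0\<close>, also
  \<open>f^(2n+2) (E u) = 0\<close>, and \<open>f^(2n+2)\<close> is injective on
  \<open>D (n + 1)\<close>, where \<open>E u\<close> lives. On \<open>D (- n)\<close> the even power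
  \<open>f^(2n)\<close> commutes with \<open>E\<close>.\<close>

lemma anticommuting_raising_zero:
  assumes E: "E \<in> linear_maps V V" "\<And>i. E ` D i \<subseteq> D (i + 1)"
    and anti: "\<And>v. v \<in> carrier V \<Longrightarrow> E (f v) \<oplus> f (E v) = \<zero>"
    and v: "v \<in> D i"
  shows "E v = \<zero>"
proof -
  note E' = linear_mapsD[OF E(1)]
  have EX: "E (f v) = (- 1) \<odot> f (E v)" if "v \<in> carrier V" for v
    using anti[OF that] that E'(1) f(1) by (metis M.minus_equality uminus_eq_scale)
  have EXk: "E ((f ^^ k) v) = (- 1) ^ k \<odot> (f ^^ k) (E v)" if "v \<in> carrier V" for v k
  proof (induction k)
    case (Suc k)
    have cl: "(f ^^ k) v \<in> carrier V" "(f ^^ k) (E v) \<in> carrier V" using that E'(1) by auto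
    show ?case using Suc EX[OF cl(1)] cl f by (simp add: scale_scale)
  qed (use that E'(1) in simp)
  have nonneg: "E v = \<zero>" if "v \<in> D (int n)" for n v
    using that
  proof (induction "N - n" arbitrary: n v rule: less_induct)
    case less
    show ?case
    proof (cases "N \<le> n")
      case True
      then show ?thesis using bounded[of n] less.prems linear_maps_zero[OF superspace_axioms superspace_axioms E(1)] by simp
    next
      case False
      define z where "z = T n v"
      have z: "z \<in> D (int (Suc n))" "(f ^^ (2 * Suc n)) z = (f ^^ Suc (2 * n)) v"
        using T[OF less.prems] by (simp_all only: z_def)
      have cl: "v \<in> carrier V" "z \<in> carrier V" "f z \<in> carrier V" using z(1) less.prems DD(1) f(1) by blast+
      have "E z = \<zero>" using less.hyps[OF _ z(1)] False by simp
      then have EXz: "E (f z) = \<zero>" using EX[OF cl(2)] pow_zero[of 1] by simp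
      let ?u = "v \<ominus> f z"
      have "f z \<in> D (int n)" using shift'[OF z(1)] by simp
      then have u: "?u \<in> D (int n)" by (rule DD(6)[OF less.prems])
      then have Eu: "E ?u \<in> D (int (Suc n))" using E(2)[of "int n"] by (auto simp: add_ac)
      have "(f ^^ Suc (2 * n)) (f z) = (f ^^ Suc (2 * n)) v" using z(2) by (simp add: funpow_swap1)
      then have "(f ^^ Suc (2 * n)) ?u = \<zero>"
        by (simp only: pow_minus[OF cl(1,3)] minus_eq_zero_iff[OF pow(1)[OF cl(1)] pow(1)[OF cl(1)]])
      then have u0: "(f ^^ (2 * Suc n)) ?u = \<zero>" using pow_zero[of 1] by (simp del: pow_minus)
      have ucl: "?u \<in> carrier V" "E ?u \<in> carrier V" using DD(1)[OF u] E'(1) by blast+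
      have "(- 1) ^ (2 * Suc n) \<odot> (f ^^ (2 * Suc n)) (E ?u) = E \<zero>"
        using EXk[OF ucl(1), of "2 * Suc n"] by (simp only: u0)
      then have "(f ^^ (2 * Suc n)) (E ?u) = (f ^^ (2 * Suc n)) \<zero>"
        using linear_maps_zero[OF superspace_axioms superspace_axioms E(1)]
          scale_eq_zero_iff[OF pow(1)[OF ucl(2)], of "(- 1) ^ (2 * Suc n)"] by (simp only: pow_zero) simp
      then have "E ?u = \<zero>" using lefschetz_inj[OF Eu DD(2)] by blast
      moreover have "E v = E (f z) \<oplus> E ?u"
        using E'(2)[of "f z" ?u] add_left_commute_cancel[of v "f z"] cl by simp
      ultimately show ?thesis using EXz by simp
    qed
  qed
  show ?thesis
  proof (cases "i \<ge> 0")
    case True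
    then show ?thesis using nonneg[of v "nat i"] v by simp
  next
    case False
    then obtain n where n: "i = - int n" using that[of "nat (- i)"] by simp
    obtain w where w: "w \<in> D (int n)" "(f ^^ (2 * n)) w = v" using lefschetz_surj v n by blast
    have "E v = (- 1) ^ (2 * n) \<odot> (f ^^ (2 * n)) (E w)" using EXk[of w "2 * n"] w DD(1) by simp
    then show ?thesis unfolding nonneg[OF w(1)] pow_zero by simp
  qed
qed

end

section \<open>Modules over osp(1|2)\<close>

lemma osp_brackets:
  fixes E F :: "'k::field_char_0^3^3"
  defines "E \<equiv> mat_superbracket osp_X osp_X" and "F \<equiv> mat_superbracket osp_Y osp_Y"
  shows "mat_superbracket osp_X osp_h = mat_scale 2 (osp_X :: 'k^3^3)"
    "mat_superbracket osp_X E = 0" "mat_superbracket osp_X F = mat_scale 4 (osp_Y :: 'k^3^3)"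
    "mat_superbracket osp_X osp_Y = (osp_h :: 'k^3^3)"
    "mat_superbracket osp_Y osp_h = mat_scale (- 2) (osp_Y :: 'k^3^3)"
    "mat_superbracket osp_Y E = mat_scale (- 4) (osp_X :: 'k^3^3)" "mat_superbracket osp_Y F = 0"
  unfolding E_def F_def by (simp_all add: mat_superbracket_def mat3_simps)

section \<open>From operators h, X, Y to an action of osp(1|2)\<close>

locale osp_triple = superspace V
  for V :: "('k::field_char_0, 'v) superspace" (structure) +
  fixes h f g :: "'v \<Rightarrow> 'v"
  assumes h_linear: "h \<in> linear_maps V V" and h_part: "v \<in> part V p \<Longrightarrow> h v \<in> part V p"
    and f_odd: "odd_operator V f" and g_odd: "odd_operator V g"
    and gf: "v \<in> carrier V \<Longrightarrow> g (f v) = h v \<ominus> f (g v)"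
    and hf: "v \<in> carrier V \<Longrightarrow> h (f v) = f (h v) \<ominus> 2 \<odot> f v"
    and hg: "v \<in> carrier V \<Longrightarrow> h (g v) = g (h v) \<oplus> 2 \<odot> g v"
begin

lemma f_linear: "f \<in> linear_maps V V" and g_linear: "g \<in> linear_maps V V"
  using f_odd g_odd by (auto simp: odd_operator_def)

lemmas linear [simp] = linear_mapsD[OF h_linear] linear_mapsD[OF f_linear] linear_mapsD[OF g_linear]
  linear_maps_minus[OF superspace_axioms superspace_axioms h_linear]
  linear_maps_minus[OF superspace_axioms superspace_axioms f_linear]
  linear_maps_minus[OF superspace_axioms superspace_axioms g_linear]
  linear_maps_zero[OF superspace_axioms superspace_axioms h_linear]
  linear_maps_zero[OF superspace_axioms superspace_axioms f_linear]
  linear_maps_zero[OF superspace_axioms superspace_axioms g_linear]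

lemma odd_part: "v \<in> part V p \<Longrightarrow> f v \<in> part V (p + 1)" "v \<in> part V p \<Longrightarrow> g v \<in> part V (p + 1)"
  using f_odd g_odd unfolding odd_operator_def by blast+

text \<open>The coefficients are those of \<open>A\<close> in the basis \<open>h\<close>, \<open>[X, X]\<close>, \<open>[Y, Y]\<close>, \<open>X\<close>, \<open>Y\<close>.\<close>

definition act :: "'k^3^3 \<Rightarrow> 'v \<Rightarrow> 'v"
  where "act A v = (A $ 2 $ 2 / 2) \<odot> h v \<oplus> ((A $ 3 $ 2 / 2) \<odot> (2 \<odot> f (f v)) \<oplus>
    ((- (A $ 2 $ 3) / 8) \<odot> (2 \<odot> g (g v)) \<oplus> ((A $ 1 $ 2) \<odot> f v \<oplus> (A $ 2 $ 1 / 2) \<odot> g v)))"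

lemma act_linear: "act A \<in> linear_maps V V"
  by (rule linear_mapsI) (simp_all add: act_def scale_add_right scale_scale M.a_ac mult.commute)

lemmas act [simp] = linear_mapsD[OF act_linear]
  linear_maps_minus[OF superspace_axioms superspace_axioms act_linear]
  linear_maps_zero[OF superspace_axioms superspace_axioms act_linear]

lemma act_add: "v \<in> carrier V \<Longrightarrow> act (A + B) v = act A v \<oplus> act B v"
  by (simp add: act_def add_divide_distrib diff_divide_distrib scale_add_left M.a_ac)
   (simp add: M.a_ac flip: scale_add_left)

lemma act_scale: "v \<in> carrier V \<Longrightarrow> act (mat_scale c A) v = c \<odot> act A v"
  by (simp add: act_def mat_scale_def scale_add_right scale_scale)

lemma act_0: "v \<in> carrier V \<Longrightarrow> act 0 v = \<zero>"
  by (simp add: act_def)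

lemma act_generators:
  assumes "v \<in> carrier V"
  shows "act osp_h v = h v" "act osp_X v = f v" "act osp_Y v = g v"
    "act (mat_superbracket osp_X osp_X) v = 2 \<odot> f (f v)"
    "act (mat_superbracket osp_Y osp_Y) v = 2 \<odot> g (g v)"
  using assms by (simp_all add: act_def mat_superbracket_def mat3_simps)

text \<open>The bracket axiom for one pair of elements. With the parities as parameters the sign is
  fixed, so the condition is linear in \<open>A\<close> and in \<open>B\<close> and can be checked
  on a basis.\<close>

definition compatible :: "bit \<Rightarrow> 'k^3^3 \<Rightarrow> bit \<Rightarrow> 'k^3^3 \<Rightarrow> bool"
  where "compatible p A q B \<longleftrightarrow> (\<forall>v\<in>carrier V.
    act (mat_superbracket A B) v = act A (act B v) \<ominus> koszul_sign p q \<odot> act B (act A v))"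

lemma compatible_linear:
  shows "compatible p A q B \<Longrightarrow> compatible p A q C \<Longrightarrow> compatible p A q (B + C)"
    "compatible p A q B \<Longrightarrow> compatible p A q (mat_scale c B)"
    "compatible p A q B \<Longrightarrow> compatible p C q B \<Longrightarrow> compatible p (A + C) q B"
    "compatible p A q B \<Longrightarrow> compatible p (mat_scale c A) q B"
  by (simp_all add: compatible_def mat_superbracket_linear act_add act_scale)
    (simp_all add: diff_simps scale_scale mult.commute)

text \<open>The pairs of an odd generator with one of the five basis vectors. Each identity unfolds
  to rewriting with \<open>gf\<close>, \<open>hf\<close> and \<open>hg\<close>.\<close>

lemma compatible_generators:
  shows "compatible 1 osp_X 0 osp_h" "compatible 1 osp_Y 0 osp_h"
    "compatible 1 osp_X 1 osp_X" "compatible 1 osp_X 1 osp_Y"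
    "compatible 1 osp_Y 1 osp_X" "compatible 1 osp_Y 1 osp_Y"
    "compatible 1 osp_X 0 (mat_superbracket osp_X osp_X)"
    "compatible 1 osp_X 0 (mat_superbracket osp_Y osp_Y)"
    "compatible 1 osp_Y 0 (mat_superbracket osp_X osp_X)"
    "compatible 1 osp_Y 0 (mat_superbracket osp_Y osp_Y)"
  by (simp_all add: compatible_def osp_brackets osp_relations act_generators act_scale act_0
      gf hf hg scale_two scale_four diff_simps)

lemma compatible_odd:
  assumes A: "A \<in> osp12_part 1" and B: "B \<in> osp12_part q"
  shows "compatible 1 A q B"
proof -
  have B': "compatible 1 osp_X q B \<and> compatible 1 osp_Y q B"
  proof (cases q)
    case zero
    then obtain a b c where "B = mat_scale a osp_h
      + mat_scale b (mat_superbracket osp_X osp_X) + mat_scale c (mat_superbracket osp_Y osp_Y)"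
      using B osp12_part_basis(1) by blast
    then show ?thesis using zero by (simp add: compatible_linear compatible_generators)
  next
    case one
    then obtain a b where "B = mat_scale a osp_X + mat_scale b osp_Y"
      using B osp12_part_basis(2) by blast
    then show ?thesis using one by (simp add: compatible_linear compatible_generators)
  qed
  obtain a b where "A = mat_scale a osp_X + mat_scale b osp_Y"
    using A osp12_part_basis(2) by blast
  then show ?thesis using B' by (simp add: compatible_linear)
qed

text \<open>For odd \<open>A\<close> and \<open>A'\<close> the super Jacobi identity reads
  \<open>[[A, A'], B] = [A, [A', B]] + [A', [A, B]]\<close>. All brackets on the right have an odd
  left entry, where compatibility is known; expanding them, the mixed terms cancel.\<close>

lemma compatible_bracket:
  assumes A: "A \<in> osp12_part 1" "A' \<in> osp12_part 1" and B: "B \<in> osp12_part q"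
  shows "compatible 0 (mat_superbracket A A') q B"
  unfolding compatible_def
proof
  fix v assume v: "v \<in> carrier V"
  have "mat_superbracket A (mat_superbracket A' B) = mat_superbracket (mat_superbracket A A') B
      + mat_scale (- 1) (mat_superbracket A' (mat_superbracket A B))"
    using osp12_super_jacobi[OF A B] by simp
  then have eq: "mat_superbracket (mat_superbracket A A') B =
      mat_superbracket A (mat_superbracket A' B) + mat_superbracket A' (mat_superbracket A B)"
    by (simp add: vec_eq_iff mat_scale_def)
  have comp: "act (mat_superbracket S T) u = act S (act T u) \<ominus> koszul_sign 1 r \<odot> act T (act S u)"
    if "S \<in> osp12_part 1" "T \<in> osp12_part r" "u \<in> carrier V" for S T r u
    using compatible_odd[OF that(1,2)] that(3) unfolding compatible_def by blast
  note P = osp12_bracket_parity[OF A(1) B] osp12_bracket_parity[OF A(2) B]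
  show "act (mat_superbracket (mat_superbracket A A') B) v =
      act (mat_superbracket A A') (act B v) \<ominus> koszul_sign 0 q \<odot> act B (act (mat_superbracket A A') v)"
    unfolding eq act_add[OF v]
    using v
    by (cases q; simp add: comp[OF A(1) P(2)] comp[OF A(2) P(1)] comp[OF A(1) B] comp[OF A(2) B] comp[OF A])
      (simp_all add: diff_simps)
qed

text \<open>The even part is spanned by the brackets \<open>h = [Y, X]\<close>,
  \<open>[X, X]\<close> and \<open>[Y, Y]\<close> of odd elements, so
  \<open>compatible_bracket\<close> covers it.\<close>

lemma compatible_homogeneous:
  assumes A: "A \<in> osp12_part p" and B: "B \<in> osp12_part q"
  shows "compatible p A q B"
proof (cases p)
  case zero
  then obtain a b c where "A = mat_scale a osp_h
    + mat_scale b (mat_superbracket osp_X osp_X) + mat_scale c (mat_superbracket osp_Y osp_Y)"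
    using A osp12_part_basis(1) by blast
  moreover have "compatible 0 osp_h q B"
    using compatible_bracket[OF osp_generators(3,2) B] unfolding osp_relations(3) .
  ultimately show ?thesis using zero
    by (simp add: compatible_linear compatible_bracket osp_generators B)
next
  case one
  then show ?thesis using compatible_odd A B by simp
qed

lemma act_part: "A \<in> osp12_part p \<Longrightarrow> v \<in> part V q \<Longrightarrow> act A v \<in> part V (p + q)"
proof (cases p)
  case zero
  assume A: "A \<in> osp12_part p" and v: "v \<in> part V q"
  have "f (f v) \<in> part V q" "g (g v) \<in> part V q"
    using odd_part[OF odd_part(1)[OF v]] odd_part[OF odd_part(2)[OF v]] by (simp_all only: bit_add_self)
  moreover have "act A v = (A $ 2 $ 2 / 2) \<odot> h v \<oplus> ((A $ 3 $ 2 / 2) \<odot> (2 \<odot> f (f v)) \<oplus>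
    (- (A $ 2 $ 3) / 8) \<odot> (2 \<odot> g (g v)))"
    using A zero partD(1)[OF v] by (simp add: osp12_part_0_iff act_def)
  ultimately show ?thesis using h_part[OF v] zero by (auto intro!: partD)
next
  case one
  assume A: "A \<in> osp12_part p" and v: "v \<in> part V q"
  have "act A v = (A $ 1 $ 2) \<odot> f v \<oplus> (A $ 2 $ 1 / 2) \<odot> g v"
    using A one partD(1)[OF v] by (simp add: osp12_part_1_iff act_def)
  moreover have "p + q = q + 1" using one by (simp only: add.commute)
  ultimately show ?thesis using odd_part[OF v] by (simp only:) (intro partD)
qed

text \<open>The restrictions make the action extensional, so that it can be unique as a function; on
  the carriers they change nothing.\<close>

lemma osp12_module:
  "lie_superalgebra_module (osp12 :: ('k, 'k^3^3) lie_superalgebra) V (restrict (\<lambda>A. restrict (act A) (carrier V)) (carrier osp12))"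
proof -
  let ?L = "osp12 :: ('k, 'k^3^3) lie_superalgebra"
  interpret L: lie_superalgebra ?L by (rule osp12_lie_superalgebra)
  have part: "A \<in> carrier ?L" if "A \<in> osp12_part p" for A p
    using L.partD(1)[of A p] that by simp
  show ?thesis
  proof (intro lie_superalgebra_module.intro lie_superalgebra_module_axioms.intro osp12_lie_superalgebra superspace_axioms)
    let ?act = "restrict (\<lambda>A. restrict (act A) (carrier V)) (carrier ?L)"
    show "(\<lambda>A. ?act A v) \<in> linear_maps ?L V" if "v \<in> carrier V" for v
      using that L.M.add.m_closed L.scale_closed by (intro linear_mapsI) (simp_all add: act_add act_scale)
    show "?act A \<in> linear_maps V V" if "A \<in> carrier ?L" for A
      using that by (intro linear_mapsI) simp_all
    show "?act A v \<in> part V (p + q)" if "A \<in> part ?L p" "v \<in> part V q" for A v p q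
      using that act_part[of A p v q] part[of A p] partD(1)[of v q] by simp
    show "?act (bracket ?L A B) v = ?act A (?act B v) \<ominus> koszul_sign p q \<odot> ?act B (?act A v)"
      if "A \<in> part ?L p" "B \<in> part ?L q" "v \<in> carrier V" for A B v p q
      using that compatible_homogeneous[of A p B q] part[of A p] part[of B q]
        part[OF osp12_bracket_parity[of A p B q]] by (simp add: compatible_def)
  qed
qed

end

section \<open>A module structure is determined by h, X and Y\<close>

lemma (in lie_superalgebra_module) act_simps:
  shows "a \<in> carrier L \<Longrightarrow> v \<in> carrier V \<Longrightarrow> act a v \<in> carrier V"
    and "a \<in> carrier L \<Longrightarrow> b \<in> carrier L \<Longrightarrow> v \<in> carrier V \<Longrightarrow> act (a \<oplus>\<^bsub>L\<^esub> b) v = act a v \<oplus>\<^bsub>V\<^esub> act b v"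
    and "a \<in> carrier L \<Longrightarrow> v \<in> carrier V \<Longrightarrow> act (c \<odot>\<^bsub>L\<^esub> a) v = c \<odot>\<^bsub>V\<^esub> act a v"
  using linear_mapsD(1)[OF act_linear_right, of a v] linear_mapsD(2)[OF act_linear_left, of v a b]
    linear_mapsD(3)[OF act_linear_left, of v a c] by simp_all

text \<open>The elements acting equally on \<open>v\<close> form a subspace. It contains
  \<open>[B, B]\<close> for \<open>B = X\<close> and \<open>B = Y\<close>, because
  \<open>[B, B]\<close> acts as twice the square of \<open>B\<close>, and hence it contains a
  basis.\<close>

lemma osp12_module_unique:
  fixes V :: "('k::field_char_0, 'v) superspace"
  assumes "lie_superalgebra_module osp12 V act1" "lie_superalgebra_module osp12 V act2"
    and eq: "\<And>v. v \<in> carrier V \<Longrightarrow> act1 osp_h v = act2 osp_h v"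
      "\<And>v. v \<in> carrier V \<Longrightarrow> act1 osp_X v = act2 osp_X v"
      "\<And>v. v \<in> carrier V \<Longrightarrow> act1 osp_Y v = act2 osp_Y v"
    and A: "A \<in> carrier osp12" and v: "v \<in> carrier V"
  shows "act1 A v = act2 A v"
proof -
  let ?L = "osp12 :: ('k, 'k^3^3) lie_superalgebra"
  interpret a: lie_superalgebra_module ?L V act1 by fact
  interpret b: lie_superalgebra_module ?L V act2 by fact
  have part: "B \<in> carrier ?L" if "B \<in> osp12_part p" for B p
    using a.L.partD(1)[of B p] that by simp
  note gen = part[OF osp_generators(1)] part[OF osp_generators(2)] part[OF osp_generators(3)]
  let ?S = "{B \<in> carrier ?L. act1 B v = act2 B v}"
  have add: "B + C \<in> ?S" if "B \<in> ?S" "C \<in> ?S" for B C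
    using that a.act_simps(2)[of B C] b.act_simps(2)[of B C] a.L.M.add.m_closed[of B C] v by simp
  have scale: "mat_scale c B \<in> ?S" if "B \<in> ?S" for B c
    using that a.act_simps(3)[of B] b.act_simps(3)[of B] a.L.scale_closed[of B c] v by simp
  have square: "mat_superbracket B B \<in> ?S"
    if B: "B \<in> osp12_part 1" and e: "\<And>v. v \<in> carrier V \<Longrightarrow> act1 B v = act2 B v" for B
    using a.act_bracket[of B 1 B 1 v] b.act_bracket[of B 1 B 1 v] B e v b.act_simps(1)[OF part[OF B]]
      part[OF osp12_bracket_parity[OF B B]] by simp
  have S: "osp_h \<in> ?S" "osp_X \<in> ?S" "osp_Y \<in> ?S" "mat_superbracket osp_X osp_X \<in> ?S"
    "mat_superbracket osp_Y osp_Y \<in> ?S"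
    using gen eq[OF v] square[OF osp_generators(2) eq(2)] square[OF osp_generators(3) eq(3)]
    by (simp_all only: mem_Collect_eq simp_thms)
  obtain A0 A1 where A: "A = A0 + A1" "A0 \<in> osp12_part 0" "A1 \<in> osp12_part 1"
    using A unfolding osp12_def by auto
  have "A0 \<in> ?S"
  proof -
    obtain a b c where A0: "A0 = mat_scale a osp_h + mat_scale b (mat_superbracket osp_X osp_X)
        + mat_scale c (mat_superbracket osp_Y osp_Y)"
      using A(2) osp12_part_basis(1) by blast
    show ?thesis unfolding A0 by (rule add scale S)+
  qed
  moreover have "A1 \<in> ?S"
  proof -
    obtain a b where A1: "A1 = mat_scale a osp_X + mat_scale b osp_Y"
      using A(3) osp12_part_basis(2) by blast
    show ?thesis unfolding A1 by (rule add scale S)+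
  qed
  ultimately have "A \<in> ?S" unfolding A(1) by (rule add)
  then show ?thesis by blast
qed

section \<open>The even part of the associated graded space\<close>

text \<open>The index convention is that component \<open>i\<close> of the image comes from
  component \<open>i + d\<close>. It is used with \<open>d = 1\<close> for X, \<open>d = 0\<close>
  for h and \<open>d = - 1\<close> for Y. Supports are translated by \<open>- d\<close>, so they
  stay finite.\<close>

lemma direct_sum_map:
  fixes V :: "int \<Rightarrow> ('k::field, 'v) superspace"
  assumes V: "\<And>i. superspace (V i)" and \<phi>: "\<And>i. \<phi> i \<in> linear_maps (V (i + d)) (V i)"
  defines "F \<equiv> \<lambda>u i. \<phi> i (u (i + d))"
  shows direct_sum_map_linear: "F \<in> linear_maps (direct_sum V) (direct_sum V)"
    and direct_sum_map_part: "\<lbrakk>\<And>i v p. v \<in> part (V (i + d)) p \<Longrightarrow> \<phi> i v \<in> part (V i) (p + q);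
      u \<in> part (direct_sum V) p\<rbrakk> \<Longrightarrow> F u \<in> part (direct_sum V) (p + q)"
proof -
  note \<phi>' = linear_mapsD[OF \<phi>]
  have fin: "finite {i. F u i \<noteq> \<zero>\<^bsub>V i\<^esub>}" if u: "finite {i. u i \<noteq> \<zero>\<^bsub>V i\<^esub>}" for u
  proof (rule finite_subset)
    show "{i. F u i \<noteq> \<zero>\<^bsub>V i\<^esub>} \<subseteq> (\<lambda>i. i - d) ` {i. u i \<noteq> \<zero>\<^bsub>V i\<^esub>}"
    proof
      fix i assume i: "i \<in> {i. F u i \<noteq> \<zero>\<^bsub>V i\<^esub>}"
      have "u (i + d) \<noteq> \<zero>\<^bsub>V (i + d)\<^esub>"
        using i linear_maps_zero[OF V V \<phi>, of i] by (auto simp: F_def)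
      then show "i \<in> (\<lambda>i. i - d) ` {i. u i \<noteq> \<zero>\<^bsub>V i\<^esub>}" by (intro image_eqI[of _ _ "i + d"]) auto
    qed
  qed (use u in simp)
  show "F \<in> linear_maps (direct_sum V) (direct_sum V)"
    by (rule linear_mapsI) (auto simp: direct_sum_simps fin, auto simp: F_def fun_eq_iff \<phi>')
  show "F u \<in> part (direct_sum V) (p + q)"
    if "\<And>i v p. v \<in> part (V (i + d)) p \<Longrightarrow> \<phi> i v \<in> part (V i) (p + q)" "u \<in> part (direct_sum V) p"
    using that fin[of u] unfolding direct_sum_simps by (simp add: F_def del: add_bit_eq_xor)
qed

section \<open>The operators X and h on the even part of the graded space\<close>

locale Ga11_rep = odd_nilpotent M x n
  for M :: "('k::field_char_0, 'm) superspace" (structure) and x :: "'m \<Rightarrow> 'm" and n :: nat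
begin

abbreviation G :: "int \<Rightarrow> ('k, 'm set) superspace"
  where "G i \<equiv> Gr M weight (2 * i)"

abbreviation V :: "('k, int \<Rightarrow> 'm set) superspace"
  where "V \<equiv> direct_sum G"

lemma Gr_ev_eq: "Gr_ev M x = V"
  by (simp add: Gr_ev_def deligne_filtration_eq)

sublocale G: superspace "G i" for i
  by (rule weight.Gr_superspace)

sublocale V: superspace V
  by (rule superspace_direct_sum) (rule weight.Gr_superspace)

definition f :: "(int \<Rightarrow> 'm set) \<Rightarrow> int \<Rightarrow> 'm set"
  where "f u = (\<lambda>i. Gr_map M weight x (2 * i) (u (i + 1)))"

definition h :: "(int \<Rightarrow> 'm set) \<Rightarrow> int \<Rightarrow> 'm set"
  where "h u = (\<lambda>i. of_int (2 * i) \<odot>\<^bsub>G i\<^esub> u i)"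

lemma Gr_ev_x_eq: "Gr_ev_x M x = f"
  by (simp add: fun_eq_iff f_def Gr_ev_x_def deligne_filtration_eq)

lemma Gr_ev_grading_eq: "Gr_ev_grading M x = h"
  by (simp add: fun_eq_iff h_def Gr_ev_grading_def deligne_filtration_eq)

lemma G_carrier:
  assumes "a \<in> carrier (G i)"
  obtains v where "v \<in> weight (2 * i)" "a = weight (2 * i - 1) +> v"
  using assms weight.Gr_simps(1) by auto

lemma Gr_map_pow:
  assumes "v \<in> weight (2 * (i + int k))"
  shows "Gr_map M weight (x ^^ k) (2 * i) (weight (2 * (i + int k) - 1) +> v) =
    weight (2 * i - 1) +> (x ^^ k) v"
proof (rule weight.Gr_map_coset[OF pow_linear _ weight_closed[OF assms]])
  have "2 * (i + int k) - 1 - 2 * int k = 2 * i - 1" by simp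
  then show "(x ^^ k) ` weight (2 * (i + int k) - 1) \<subseteq> weight (2 * i - 1)"
    using weight_shift_pow[of _ "2 * (i + int k) - 1" k] by auto
qed

lemma Gr_map_x_linear: "Gr_map M weight x (2 * i) \<in> linear_maps (G (i + 1)) (G i)"
proof (rule weight.Gr_map_linear[OF x_linear])
  show "x ` weight (2 * (i + 1) - 1) \<subseteq> weight (2 * i - 1)" "x ` weight (2 * (i + 1)) \<subseteq> weight (2 * i)"
    using weight_shift[of _ "2 * (i + 1) - 1"] weight_shift[of _ "2 * (i + 1)"] by auto
qed

lemma Gr_map_x_part:
  assumes "a \<in> part (G (i + 1)) p"
  shows "Gr_map M weight x (2 * i) a \<in> part (G i) (p + 1)"
proof -
  obtain v where v: "v \<in> weight (2 * (i + 1))" "v \<in> part M p" "a = weight (2 * (i + 1) - 1) +> v"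
    using assms unfolding weight.Gr_simps by blast
  have "x v \<in> weight (2 * i)" using weight_shift[OF v(1)] by simp
  moreover have "x v \<in> part M (p + 1)" using odd v(2) unfolding odd_operator_def by blast
  moreover have "Gr_map M weight x (2 * i) a = weight (2 * i - 1) +> x v"
    using Gr_map_pow[of v i 1] v by simp
  ultimately show ?thesis unfolding weight.Gr_simps by blast
qed

lemma f_linear: "f \<in> linear_maps V V"
  unfolding f_def[abs_def]
  by (rule direct_sum_map_linear[where V = G and d = 1, OF weight.Gr_superspace Gr_map_x_linear])

lemma f_part: "u \<in> part V p \<Longrightarrow> f u \<in> part V (p + 1)"
  unfolding f_def[abs_def]
  by (rule direct_sum_map_part[where V = G and d = 1, OF weight.Gr_superspace Gr_map_x_linear Gr_map_x_part])

lemma f_odd: "odd_operator V f"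
  using f_linear f_part unfolding odd_operator_def by blast

sublocale f: odd_superspace V f
  by unfold_locales (rule f_odd)

lemma h_linear: "h \<in> linear_maps V V"
proof -
  have "(\<odot>\<^bsub>G i\<^esub>) (of_int (2 * i)) \<in> linear_maps (G (i + 0)) (G i)" for i
    using G.scale_linear by simp
  from direct_sum_map_linear[where V = G and d = 0, OF weight.Gr_superspace this]
  show ?thesis by (simp add: h_def[abs_def])
qed

lemma h_part: "u \<in> part V p \<Longrightarrow> h u \<in> part V p"
  by (auto simp: h_def direct_sum_simps G.partD elim: finite_subset[rotated])

text \<open>Powers of the induced operator are induced by the powers of \<open>x\<close>. The
  Deligne filtration speaks of the latter, the Lefschetz condition of the former.\<close>

lemma f_pow:
  assumes "u \<in> carrier V"
  shows "(f ^^ k) u = (\<lambda>i. Gr_map M weight (x ^^ k) (2 * i) (u (i + int k)))"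
proof (induction k)
  case 0
  show ?case
  proof
    fix i
    obtain v where v: "v \<in> weight (2 * i)" "u i = weight (2 * i - 1) +> v"
      using assms G_carrier unfolding direct_sum_simps by blast
    then show "(f ^^ 0) u i = Gr_map M weight (x ^^ 0) (2 * i) (u (i + int 0))"
      using Gr_map_pow[of v i 0] by simp
  qed
next
  case (Suc k)
  show ?case
  proof
    fix i
    let ?j = "i + 1 + int k"
    obtain v where v: "v \<in> weight (2 * ?j)" "u ?j = weight (2 * ?j - 1) +> v"
      using assms G_carrier unfolding direct_sum_simps by blast
    have xv: "(x ^^ k) v \<in> weight (2 * (i + 1))"
      using weight_shift_pow[OF v(1), of k] by (simp add: algebra_simps)
    have j: "i + int (Suc k) = ?j" by simp
    have "(f ^^ Suc k) u i = Gr_map M weight x (2 * i) (Gr_map M weight (x ^^ k) (2 * (i + 1)) (u ?j))"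
      by (simp add: Suc f_def)
    also have "\<dots> = weight (2 * i - 1) +> x ((x ^^ k) v)"
      using Gr_map_pow[OF v(1)] Gr_map_pow[of "(x ^^ k) v" i 1] xv v(2) by simp
    also have "\<dots> = Gr_map M weight (x ^^ Suc k) (2 * i) (u (i + int (Suc k)))"
      using Gr_map_pow[of v i "Suc k"] v unfolding j by simp
    finally show "(f ^^ Suc k) u i = Gr_map M weight (x ^^ Suc k) (2 * i) (u (i + int (Suc k)))" .
  qed
qed

section \<open>Homogeneous components of the direct sum\<close>

definition single :: "int \<Rightarrow> 'm set \<Rightarrow> int \<Rightarrow> 'm set"
  where "single i a = (\<lambda>j. if j = i then a else \<zero>\<^bsub>G j\<^esub>)"

lemma single_simps [simp]: "single i a i = a" "j \<noteq> i \<Longrightarrow> single i a j = \<zero>\<^bsub>G j\<^esub>"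
  by (simp_all add: single_def)

definition D :: "int \<Rightarrow> (int \<Rightarrow> 'm set) set"
  where "D i = {u \<in> carrier V. \<forall>j. j \<noteq> i \<longrightarrow> u j = \<zero>\<^bsub>G j\<^esub>}"

lemma single_finite: "finite {j. single i a j \<noteq> \<zero>\<^bsub>G j\<^esub>}"
  by (rule finite_subset[of _ "{i}"]) (auto simp: single_def)

lemma single_D: "a \<in> carrier (G i) \<Longrightarrow> single i a \<in> D i"
  unfolding D_def by (simp add: direct_sum_simps single_finite) (simp add: single_def)

lemma single_part: "a \<in> part (G i) p \<Longrightarrow> single i a \<in> part V p"
  by (simp add: direct_sum_simps single_finite) (simp add: single_def G.partD)

lemma D_eq_single: "u \<in> D i \<Longrightarrow> u = single i (u i)"
  by (rule ext) (simp add: D_def single_def)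

lemma V_component: "u \<in> carrier V \<Longrightarrow> u i \<in> carrier (G i)"
  by (simp add: direct_sum_simps)

lemma D_subsuperspace: "subsuperspace (D i) V"
proof (rule V.subsuperspaceI)
  show "submodule (D i) scalars V"
    by (rule V.submoduleI') (auto simp: D_def, auto simp: direct_sum_simps)
  show "a \<in> D i \<and> b \<in> D i" if "a \<in> part V 0" "b \<in> part V 1" "a \<oplus>\<^bsub>V\<^esub> b \<in> D i" for a b
  proof -
    have "a j = \<zero>\<^bsub>G j\<^esub> \<and> b j = \<zero>\<^bsub>G j\<^esub>" if "j \<noteq> i" for j
      using \<open>a \<in> part V 0\<close> \<open>b \<in> part V 1\<close> \<open>a \<oplus>\<^bsub>V\<^esub> b \<in> D i\<close> that
      by (intro G.parity_decomposition_unique) (auto simp: D_def direct_sum_simps G.partD)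
    then show ?thesis using that V.partD(1) by (auto simp: D_def)
  qed
qed

lemma f_shift: "f ` D i \<subseteq> D (i - 1)"
proof
  fix w assume "w \<in> f ` D i"
  then obtain u where u: "u \<in> D i" "w = f u" by blast
  have "f u j = \<zero>\<^bsub>G j\<^esub>" if "j \<noteq> i - 1" for j
  proof -
    have "u (j + 1) = \<zero>\<^bsub>G (j + 1)\<^esub>" using u(1) that by (auto simp: D_def)
    then show ?thesis
      using linear_maps_zero[OF weight.Gr_superspace weight.Gr_superspace Gr_map_x_linear] by (simp add: f_def)
  qed
  then show "w \<in> D (i - 1)" using u linear_mapsD(1)[OF f_linear] by (auto simp: D_def)
qed

lemma f_pow_D: "u \<in> D i \<Longrightarrow> (f ^^ k) u \<in> D (i - int k)"
proof (induction k)
  case (Suc k)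
  then have "f ((f ^^ k) u) \<in> D (i - int k - 1)" using f_shift by blast
  then show ?case by (simp add: algebra_simps)
qed simp

text \<open>The isomorphism of the Deligne filtration in degree \<open>2k\<close>, transported along
  the identification of \<open>D k\<close> with the graded piece of degree \<open>2k\<close> that
  evaluation at \<open>k\<close> provides.\<close>

lemma f_lefschetz: "bij_betw (f ^^ (2 * k)) (D (int k)) (D (- int k))"
proof -
  let ?\<phi> = "Gr_map M weight (x ^^ (2 * k)) (2 * (- int k))"
  have "superspace_iso (Gr M weight (int (2 * k))) (parity_shift (2 * k) (Gr M weight (- int (2 * k))))
    (Gr_map M weight (x ^^ (2 * k)) (- int (2 * k)))"
    using weight_deligne unfolding is_deligne_filtration_def by blast
  then have bij: "bij_betw ?\<phi> (carrier (G (int k))) (carrier (G (- int k)))"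
    by (simp add: superspace_iso_def parity_shift_def)
  have comp: "(f ^^ (2 * k)) u (- int k) = ?\<phi> (u (int k))" if "u \<in> D (int k)" for u
    using that f_pow[of u "2 * k"] by (simp add: D_def)
  have D: "(f ^^ (2 * k)) u \<in> D (- int k)" if "u \<in> D (int k)" for u
    using f_pow_D[OF that, of "2 * k"] by simp
  show ?thesis
  proof (rule bij_betw_imageI)
    show "inj_on (f ^^ (2 * k)) (D (int k))"
    proof (rule inj_onI)
      fix u w assume uw: "u \<in> D (int k)" "w \<in> D (int k)" "(f ^^ (2 * k)) u = (f ^^ (2 * k)) w"
      then have "?\<phi> (u (int k)) = ?\<phi> (w (int k))" using comp by metis
      then have "u (int k) = w (int k)"
        using bij uw(1,2) V_component by (auto simp: D_def bij_betw_def inj_on_def)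
      then show "u = w" using D_eq_single[OF uw(1)] D_eq_single[OF uw(2)] by simp
    qed
    show "(f ^^ (2 * k)) ` D (int k) = D (- int k)"
    proof (intro equalityI subsetI)
      fix w assume w: "w \<in> D (- int k)"
      then have "w (- int k) \<in> carrier (G (- int k))" using V_component by (simp only: D_def mem_Collect_eq)
      then have "w (- int k) \<in> ?\<phi> ` carrier (G (int k))" unfolding bij_betw_imp_surj_on[OF bij] .
      then obtain a where a: "a \<in> carrier (G (int k))" "?\<phi> a = w (- int k)" by auto
      note s = single_D[OF a(1)]
      have "(f ^^ (2 * k)) (single (int k) a) = w"
        using D_eq_single[OF D[OF s]] D_eq_single[OF w] comp[OF s] a(2) by simp
      then show "w \<in> (f ^^ (2 * k)) ` D (int k)" using s by blast
    qed (use D in auto)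
  qed
qed

text \<open>Then \<open>2k - 1 >= n\<close>, so the lower filtration step
  \<open>weight (2k - 1)\<close> is already all of \<open>M\<close> and the quotient
  vanishes.\<close>

lemma D_bounded:
  assumes "Suc n \<le> k"
  shows "D (int k) = {\<zero>\<^bsub>V\<^esub>}"
proof -
  have top: "weight (2 * int k - 1) = carrier M" using assms by (intro weight_top) simp
  have zero: "a = \<zero>\<^bsub>G (int k)\<^esub>" if a: "a \<in> carrier (G (int k))" for a
  proof -
    obtain v where v: "v \<in> weight (2 * int k)" "a = weight (2 * int k - 1) +> v"
      by (rule G_carrier[OF a])
    have "weight (2 * int k - 1) +> v = weight (2 * int k - 1) +> \<zero>"
      by (rule coset_eq_iff[OF weight_subsuperspace, THEN iffD2]) (simp_all add: weight_closed[OF v(1)] top)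
    then show ?thesis using v(2) coset_zero[OF weight_subsuperspace] by (simp add: weight.Gr_simps)
  qed
  have "u = \<zero>\<^bsub>V\<^esub>" if u: "u \<in> D (int k)" for u
  proof
    fix j
    show "u j = \<zero>\<^bsub>V\<^esub> j"
      using u zero[of "u j"] by (cases "j = int k") (auto simp: D_def direct_sum_simps)
  qed
  moreover have "\<zero>\<^bsub>V\<^esub> \<in> D (int k)" using V.submoduleD(2)[OF V.subsuperspaceD(1)[OF D_subsuperspace]] .
  ultimately show ?thesis by blast
qed

section \<open>The operator Y and the relations with X and h\<close>

sublocale lef: graded_lefschetz V f D "Suc n"
  by unfold_locales (rule D_subsuperspace f_shift f_lefschetz D_bounded, assumption?)+

text \<open>Glues the degreewise operators \<open>lef.Y\<close>. The index is written
  \<open>i + - 1\<close> to match \<open>direct_sum_map\<close> with \<open>d = - 1\<close>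
  literally.\<close>

definition g :: "(int \<Rightarrow> 'm set) \<Rightarrow> int \<Rightarrow> 'm set"
  where "g u = (\<lambda>i. lef.Y (i + - 1) (single (i + - 1) (u (i + - 1))) i)"

lemma single_linear:
  "a \<in> carrier (G i) \<Longrightarrow> b \<in> carrier (G i) \<Longrightarrow> single i (a \<oplus>\<^bsub>G i\<^esub> b) = single i a \<oplus>\<^bsub>V\<^esub> single i b"
  "single i (c \<odot>\<^bsub>G i\<^esub> a) = c \<odot>\<^bsub>V\<^esub> single i a"
  by (auto simp: fun_eq_iff direct_sum_simps single_def)

lemma D_carrier: "u \<in> D i \<Longrightarrow> u \<in> carrier V"
  by (simp add: D_def)

lemma g_component_linear:
  "(\<lambda>a. lef.Y (i + - 1) (single (i + - 1) a) i) \<in> linear_maps (G (i + - 1)) (G i)"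
proof (rule linear_mapsI)
  note Y = lef.raisingD[OF lef.raising_Y[of "i + - 1"]]
  fix a assume a: "a \<in> carrier (G (i + - 1))"
  note s = single_D[OF a]
  show "lef.Y (i + - 1) (single (i + - 1) a) i \<in> carrier (G i)"
    by (rule V_component[OF D_carrier[OF Y(1)[OF s]]])
  show "lef.Y (i + - 1) (single (i + - 1) (a \<oplus>\<^bsub>G (i + - 1)\<^esub> b)) i =
      lef.Y (i + - 1) (single (i + - 1) a) i \<oplus>\<^bsub>G i\<^esub> lef.Y (i + - 1) (single (i + - 1) b) i"
    if b: "b \<in> carrier (G (i + - 1))" for b
    unfolding single_linear(1)[OF a b] Y(2)[OF s single_D[OF b]] by (simp add: direct_sum_simps)
  show "lef.Y (i + - 1) (single (i + - 1) (c \<odot>\<^bsub>G (i + - 1)\<^esub> a)) i =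
      c \<odot>\<^bsub>G i\<^esub> lef.Y (i + - 1) (single (i + - 1) a) i" for c
    unfolding single_linear(2) Y(3)[OF s] by (simp add: direct_sum_simps)
qed

lemma g_component_part:
  assumes "a \<in> part (G (i + - 1)) p"
  shows "lef.Y (i + - 1) (single (i + - 1) a) i \<in> part (G i) (p + 1)"
proof -
  have "lef.Y (i + - 1) (single (i + - 1) a) \<in> part V (p + 1)"
    by (rule lef.raisingD(4)[OF lef.raising_Y single_D single_part])
      (use assms G.partD in blast)+
  then show ?thesis by (simp add: direct_sum_simps)
qed

lemma g_linear: "g \<in> linear_maps V V"
  using direct_sum_map_linear[where V = G and d = "- 1", OF weight.Gr_superspace g_component_linear]
  unfolding g_def[abs_def] .

lemma g_part: "u \<in> part V p \<Longrightarrow> g u \<in> part V (p + 1)"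
  unfolding g_def[abs_def]
  by (rule direct_sum_map_part[where V = G and d = "- 1", OF weight.Gr_superspace g_component_linear g_component_part])

lemma g_odd: "odd_operator V g"
  using g_linear g_part unfolding odd_operator_def by blast

text \<open>At index \<open>i\<close> both sides depend only on \<open>u i\<close>, so
  \<open>u\<close> may be replaced by \<open>single i (u i)\<close>, which lies in
  \<open>D i\<close>.\<close>

lemma g_f_anticommutator:
  assumes u: "u \<in> carrier V"
  shows "g (f u) \<oplus>\<^bsub>V\<^esub> f (g u) = h u"
proof
  fix i
  let ?s = "single i (u i)"
  have s: "?s \<in> D i" by (rule single_D[OF V_component[OF u]])
  have fs: "f ?s \<in> D (i - 1)" using f_shift s by blast
  have "single (i - 1) (f u (i - 1)) = f ?s"
    using D_eq_single[OF fs] by (simp add: f_def)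
  then have 1: "g (f u) i = lef.Y (i - 1) (f ?s) i" by (simp add: g_def)
  have 2: "f (g u) i = f (lef.Y i ?s) i" by (simp add: f_def g_def)
  have "(lef.Y (i - 1) (f ?s) \<oplus>\<^bsub>V\<^esub> f (lef.Y i ?s)) i = (of_int (2 * i) \<odot>\<^bsub>V\<^esub> ?s) i"
    by (simp only: lef.Y_anticommutator[OF s])
  then show "(g (f u) \<oplus>\<^bsub>V\<^esub> f (g u)) i = h u i"
    by (simp add: direct_sum_simps 1 2 h_def)
qed

lemma h_f_commutator:
  assumes u: "u \<in> carrier V"
  shows "h (f u) \<oplus>\<^bsub>V\<^esub> 2 \<odot>\<^bsub>V\<^esub> f u = f (h u)"
proof
  fix i
  have cl: "f u i \<in> carrier (G i)" "u (i + 1) \<in> carrier (G (i + 1))"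
    using V_component u linear_mapsD(1)[OF f_linear u] by blast+
  have "f (h u) i = of_int (2 * (i + 1)) \<odot>\<^bsub>G i\<^esub> f u i"
    using linear_mapsD(3)[OF Gr_map_x_linear cl(2)] by (simp add: f_def h_def)
  also have "\<dots> = of_int (2 * i) \<odot>\<^bsub>G i\<^esub> f u i \<oplus>\<^bsub>G i\<^esub> 2 \<odot>\<^bsub>G i\<^esub> f u i"
    using cl(1) by (simp add: distrib_left flip: G.scale_add_left)
  finally show "(h (f u) \<oplus>\<^bsub>V\<^esub> 2 \<odot>\<^bsub>V\<^esub> f u) i = f (h u) i"
    by (simp add: direct_sum_simps h_def)
qed

lemma h_g_commutator:
  assumes u: "u \<in> carrier V"
  shows "h (g u) = g (h u) \<oplus>\<^bsub>V\<^esub> 2 \<odot>\<^bsub>V\<^esub> g u"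
proof
  fix i
  have cl: "g u i \<in> carrier (G i)" "u (i + - 1) \<in> carrier (G (i + - 1))"
    using V_component u linear_mapsD(1)[OF g_linear u] by blast+
  have "g (h u) i = of_int (2 * (i + - 1)) \<odot>\<^bsub>G i\<^esub> g u i"
    using linear_mapsD(3)[OF g_component_linear cl(2)] by (simp add: g_def h_def)
  moreover have "(of_int (2 * i) :: 'k) = of_int (2 * (i + - 1)) + 2" by simp
  ultimately show "h (g u) i = (g (h u) \<oplus>\<^bsub>V\<^esub> 2 \<odot>\<^bsub>V\<^esub> g u) i"
    by (simp only: direct_sum_simps h_def G.scale_add_left[OF cl(1)])
qed

sublocale osp: osp_triple V h f g
proof
  note cl = linear_mapsD(1)[OF h_linear] linear_mapsD(1)[OF f_linear] linear_mapsD(1)[OF g_linear]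
  show "h \<in> linear_maps V V" "odd_operator V f" "odd_operator V g" by (fact h_linear f_odd g_odd)+
  show "h u \<in> part V p" if "u \<in> part V p" for u p by (rule h_part[OF that])
  fix u assume u: "u \<in> carrier V"
  show "g (f u) = h u \<ominus>\<^bsub>V\<^esub> f (g u)"
    using g_f_anticommutator[OF u] cl u by (simp add: V.eq_minus_iff)
  show "h (f u) = f (h u) \<ominus>\<^bsub>V\<^esub> 2 \<odot>\<^bsub>V\<^esub> f u"
    using h_f_commutator[OF u] cl u by (simp add: V.eq_minus_iff)
  show "h (g u) = g (h u) \<oplus>\<^bsub>V\<^esub> 2 \<odot>\<^bsub>V\<^esub> g u" by (rule h_g_commutator[OF u])
qed

section \<open>Uniqueness of the operator Y\<close>

lemma linear_zero_on_D:
  assumes E: "E \<in> linear_maps V V" and zero: "\<And>i u. u \<in> D i \<Longrightarrow> E u = \<zero>\<^bsub>V\<^esub>" and u: "u \<in> carrier V"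
  shows "E u = \<zero>\<^bsub>V\<^esub>"
  using u
proof (induction "card {i. u i \<noteq> \<zero>\<^bsub>G i\<^esub>}" arbitrary: u)
  case 0
  then have "u = \<zero>\<^bsub>V\<^esub>" by (auto simp: direct_sum_simps)
  then show ?case using linear_maps_zero[OF V.superspace_axioms V.superspace_axioms E] by simp
next
  case (Suc m)
  then obtain i where i: "u i \<noteq> \<zero>\<^bsub>G i\<^esub>" by fastforce
  define w where "w = u(i := \<zero>\<^bsub>G i\<^esub>)"
  have supp: "{j. w j \<noteq> \<zero>\<^bsub>G j\<^esub>} = {j. u j \<noteq> \<zero>\<^bsub>G j\<^esub>} - {i}" by (auto simp: w_def)
  have w: "w \<in> carrier V"
    using Suc.prems unfolding direct_sum_simps supp by (auto simp: w_def)
  have "card {j. w j \<noteq> \<zero>\<^bsub>G j\<^esub>} = m" unfolding supp using Suc(2) i by simp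
  then have Ew: "E w = \<zero>\<^bsub>V\<^esub>" using Suc(1) w by simp
  note s = single_D[OF V_component[OF Suc.prems], of i]
  have "u = w \<oplus>\<^bsub>V\<^esub> single i (u i)"
    using V_component[OF Suc.prems] by (auto simp: fun_eq_iff direct_sum_simps w_def single_def)
  then have "E u = E w \<oplus>\<^bsub>V\<^esub> E (single i (u i))"
    using linear_mapsD(2)[OF E w D_carrier[OF s]] by simp
  then show ?case using Ew zero[OF s] by simp
qed

text \<open>In characteristic zero the scalars \<open>2i\<close> are pairwise distinct, so the
  degree of a vector can be read off from the action of \<open>h\<close>.\<close>

lemma h_D:
  assumes "u \<in> carrier V"
  shows "u \<in> D i \<longleftrightarrow> h u = of_int (2 * i) \<odot>\<^bsub>V\<^esub> u"
proof
  assume u: "u \<in> D i"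
  show "h u = of_int (2 * i) \<odot>\<^bsub>V\<^esub> u"
  proof
    fix j
    show "h u j = (of_int (2 * i) \<odot>\<^bsub>V\<^esub> u) j"
      using u by (cases "j = i") (auto simp: D_def h_def direct_sum_simps)
  qed
next
  assume eq: "h u = of_int (2 * i) \<odot>\<^bsub>V\<^esub> u"
  have "u j = \<zero>\<^bsub>G j\<^esub>" if "j \<noteq> i" for j
  proof -
    have cl: "u j \<in> carrier (G j)" by (rule V_component[OF assms])
    have "of_int (2 * j) \<odot>\<^bsub>G j\<^esub> u j = of_int (2 * i) \<odot>\<^bsub>G j\<^esub> u j"
      using fun_cong[OF eq, of j] by (simp add: h_def direct_sum_simps)
    then have "(of_int (2 * j) + - of_int (2 * i)) \<odot>\<^bsub>G j\<^esub> u j = \<zero>\<^bsub>G j\<^esub>"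
      using cl unfolding G.scale_add_left[OF cl] by (simp add: G.scale_minus_left G.M.r_neg)
    then have "(of_int (2 * j) + - of_int (2 * i) :: 'k) = 0 \<or> u j = \<zero>\<^bsub>G j\<^esub>"
      using cl G.scale_eq_zero_iff by blast
    moreover have "(of_int (2 * j) + - of_int (2 * i) :: 'k) \<noteq> 0" using that by simp
    ultimately show ?thesis by blast
  qed
  then show "u \<in> D i" using assms by (simp add: D_def)
qed

text \<open>Extracts from a module structure what the uniqueness argument uses:
  \<open>[Y, X] = h\<close> gives the anticommutator, and \<open>[h, Y] = 2 Y\<close> raises the
  eigenvalue of \<open>h\<close> by \<open>2\<close>, hence the degree by one.\<close>

lemma osp_Y_relations:
  assumes act: "lie_superalgebra_module osp12 V act"
    and h: "\<forall>u\<in>carrier V. act osp_h u = h u" and f: "\<forall>u\<in>carrier V. act osp_X u = f u"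
  shows "act osp_Y \<in> linear_maps V V"
    and "u \<in> carrier V \<Longrightarrow> act osp_Y (f u) \<oplus>\<^bsub>V\<^esub> f (act osp_Y u) = h u"
    and "u \<in> D i \<Longrightarrow> act osp_Y u \<in> D (i + 1)"
proof -
  interpret a: lie_superalgebra_module osp12 V act by fact
  note gen = osp_generators[where 'k = 'k]
  have part: "B \<in> carrier (osp12 :: ('k, 'k^3^3) lie_superalgebra)" if "B \<in> osp12_part p" for B p
    using a.L.partD(1)[of B p] that by simp
  note Y_part = part[OF gen(3)]
  show lin: "act osp_Y \<in> linear_maps V V" by (rule a.act_linear_right[OF Y_part])
  note Y = linear_mapsD[OF lin]
  note cl = linear_mapsD(1)[OF h_linear] linear_mapsD(1)[OF f_linear] Y(1)
  show "act osp_Y (f u) \<oplus>\<^bsub>V\<^esub> f (act osp_Y u) = h u" if u: "u \<in> carrier V" for u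
    using a.act_bracket[of osp_Y 1 osp_X 1 u] gen u cl
    by (simp add: osp_relations h f V.diff_simps)
  show "act osp_Y u \<in> D (i + 1)" if u: "u \<in> D i" for u i
  proof -
    have uV: "u \<in> carrier V" by (rule D_carrier[OF u])
    have "2 \<odot>\<^bsub>V\<^esub> act osp_Y u = h (act osp_Y u) \<ominus>\<^bsub>V\<^esub> act osp_Y (h u)"
      using a.act_bracket[of osp_h 0 osp_Y 1 u] a.act_simps(3)[OF Y_part uV, of 2] gen uV cl
      by (simp add: osp_relations h)
    moreover have "act osp_Y (h u) = of_int (2 * i) \<odot>\<^bsub>V\<^esub> act osp_Y u"
      using h_D[OF uV] u Y(3)[OF uV] by simp
    ultimately have "h (act osp_Y u) = 2 \<odot>\<^bsub>V\<^esub> act osp_Y u \<oplus>\<^bsub>V\<^esub> of_int (2 * i) \<odot>\<^bsub>V\<^esub> act osp_Y u"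
      using cl uV by (simp add: V.eq_minus_iff)
    also have "\<dots> = (2 + of_int (2 * i)) \<odot>\<^bsub>V\<^esub> act osp_Y u"
      by (rule V.scale_add_left[OF cl(3)[OF uV], symmetric])
    also have "(2 + of_int (2 * i) :: 'k) = of_int (2 * (i + 1))" by simp
    finally show ?thesis using h_D[OF cl(3)[OF uV]] by blast
  qed
qed

lemma osp_Y_unique:
  assumes act1: "lie_superalgebra_module osp12 V act1" "\<forall>u\<in>carrier V. act1 osp_h u = h u" "\<forall>u\<in>carrier V. act1 osp_X u = f u"
    and act2: "lie_superalgebra_module osp12 V act2" "\<forall>u\<in>carrier V. act2 osp_h u = h u" "\<forall>u\<in>carrier V. act2 osp_X u = f u"
    and u: "u \<in> carrier V"
  shows "act1 osp_Y u = act2 osp_Y u"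
proof -
  note Y1 = osp_Y_relations[OF act1] and Y2 = osp_Y_relations[OF act2]
  note cl = linear_mapsD(1)[OF Y1(1)] linear_mapsD(1)[OF Y2(1)] linear_mapsD(1)[OF f_linear]
  define E where "E u = act1 osp_Y u \<ominus>\<^bsub>V\<^esub> act2 osp_Y u" for u
  have E: "E \<in> linear_maps V V"
    using linear_mapsD[OF Y1(1)] linear_mapsD[OF Y2(1)]
    by (intro linear_mapsI) (simp_all add: E_def V.scale_diff V.minus_add_minus)
  have "E ` D i \<subseteq> D (i + 1)" for i
    using Y1(3) Y2(3) lef.DD(6) by (auto simp: E_def)
  moreover have "E (f v) \<oplus>\<^bsub>V\<^esub> f (E v) = \<zero>\<^bsub>V\<^esub>" if v: "v \<in> carrier V" for v
  proof -
    have "E (f v) \<oplus>\<^bsub>V\<^esub> f (E v) = (act1 osp_Y (f v) \<oplus>\<^bsub>V\<^esub> f (act1 osp_Y v)) \<ominus>\<^bsub>V\<^esub> (act2 osp_Y (f v) \<oplus>\<^bsub>V\<^esub> f (act2 osp_Y v))"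
      using cl v linear_maps_minus[OF V.superspace_axioms V.superspace_axioms f_linear]
      by (simp add: E_def V.minus_add_minus)
    then show ?thesis using Y1(2)[OF v] Y2(2)[OF v] linear_mapsD(1)[OF h_linear v] by (simp add: V.minus_eq_zero_iff)
  qed
  ultimately have "E v = \<zero>\<^bsub>V\<^esub>" if "v \<in> D i" for v i
    using lef.anticommuting_raising_zero[OF E] that by blast
  then have "E u = \<zero>\<^bsub>V\<^esub>" by (rule linear_zero_on_D[OF E _ u])
  then show ?thesis using cl u by (simp add: E_def V.minus_eq_zero_iff)
qed

end

section \<open>Existence and uniqueness of the osp(1|2)-structure\<close>

theorem lemma3p5p1:
  fixes M :: "('k::{alg_closed_field, field_char_0}, 'm) superspace"
    and x :: "'m \<Rightarrow> 'm"
  assumes "Ga11_module M x"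
  shows "\<exists>!act. act \<in> carrier osp12 \<rightarrow>\<^sub>E (carrier (Gr_ev M x) \<rightarrow>\<^sub>E carrier (Gr_ev M x)) \<and>
    lie_superalgebra_module osp12 (Gr_ev M x) act \<and>
    (\<forall>u\<in>carrier (Gr_ev M x). act osp_h u = Gr_ev_grading M x u) \<and>
    (\<forall>u\<in>carrier (Gr_ev M x). act osp_X u = Gr_ev_x M x u)"
proof -
  obtain n where n: "\<And>v. v \<in> carrier M \<Longrightarrow> (x ^^ n) v = \<zero>\<^bsub>M\<^esub>" and "superspace M" "odd_operator M x"
    using assms unfolding Ga11_module_def by blast
  then interpret Ga11_rep M x n
    by (intro Ga11_rep.intro odd_nilpotent.intro odd_superspace.intro odd_superspace_axioms.intro
        odd_nilpotent_axioms.intro)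
  let ?L = "osp12 :: ('k, 'k^3^3) lie_superalgebra"
  let ?act = "restrict (\<lambda>A. restrict (osp.act A) (carrier V)) (carrier ?L)"
  have gen: "osp_h \<in> carrier ?L" "osp_X \<in> carrier ?L"
    by (simp_all add: osp12_carrier_iff mat3_simps)
  show ?thesis unfolding Gr_ev_eq Gr_ev_grading_eq Gr_ev_x_eq
  proof (intro ex1I[of _ ?act] conjI ballI)
    show "?act \<in> carrier ?L \<rightarrow>\<^sub>E (carrier V \<rightarrow>\<^sub>E carrier V)" by auto
    show act: "lie_superalgebra_module ?L V ?act" by (rule osp.osp12_module)
    show h: "?act osp_h u = h u" and f: "?act osp_X u = f u" if "u \<in> carrier V" for u
      using that gen by (simp_all add: osp.act_generators)
    fix act assume *: "act \<in> carrier ?L \<rightarrow>\<^sub>E (carrier V \<rightarrow>\<^sub>E carrier V) \<and> lie_superalgebra_module ?L V act \<and>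
      (\<forall>u\<in>carrier V. act osp_h u = h u) \<and> (\<forall>u\<in>carrier V. act osp_X u = f u)"
    then have act': "lie_superalgebra_module ?L V act" and
      hf': "\<forall>u\<in>carrier V. act osp_h u = h u" "\<forall>u\<in>carrier V. act osp_X u = f u" by blast+
    have hf: "\<forall>u\<in>carrier V. ?act osp_h u = h u" "\<forall>u\<in>carrier V. ?act osp_X u = f u"
      using h f by blast+
    have eq: "act A u = ?act A u" if A: "A \<in> carrier ?L" and u: "u \<in> carrier V" for A u
    proof (rule osp12_module_unique[OF act' act _ _ _ A u])
      fix v assume v: "v \<in> carrier V"
      show "act osp_h v = ?act osp_h v" using hf'(1) h[OF v] v by metis
      show "act osp_X v = ?act osp_X v" using hf'(2) f[OF v] v by metis
      show "act osp_Y v = ?act osp_Y v" by (rule osp_Y_unique[OF act' hf' act hf v])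
    qed
    \<comment> \<open>Both actions lie in the same extensional function spaces, so agreement on the
      carriers gives equality of functions.\<close>
    show "act = ?act"
    proof (rule PiE_ext[of _ "carrier ?L" "\<lambda>_. carrier V \<rightarrow>\<^sub>E carrier V"])
      fix A assume A: "A \<in> carrier ?L"
      show "act A = ?act A"
      proof (rule PiE_ext[of _ "carrier V" "\<lambda>_. carrier V"])
        show "act A \<in> carrier V \<rightarrow>\<^sub>E carrier V" by (rule PiE_mem[OF conjunct1[OF *] A])
        show "?act A \<in> carrier V \<rightarrow>\<^sub>E carrier V" using A by auto
      qed (rule eq[OF A])
    qed (use * in auto)
  qed
qed

end
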